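(* Let $E$ be a Banach lattice of measurable functions on $\mathbb{R}^2$. If the function $w(x_1,x_2)=|x_2|^{-1}$ belongs to $E$, then $\mathbf{K}$ is bounded as an operator from $L^\infty(\mathbb{R})\hat\otimes_\pi H^1(\mathbb{R})$ to $E$, and $$\|\mathbf{K}\|_{L^\infty(\mathbb{R})\hat\otimes_\pi H^1(\mathbb{R})\to E}\le\|w\|_E.$$
   Context: $H^1(\mathbb{R})$ is the real Hardy space of $g\in L^1(\mathbb{R})$ with $Hg\in L^1(\mathbb{R})$, normed by $\|g\|_{H^1}=\|g\|_1+\|Hg\|_1$, where $Hg(x)=\frac1\pi\,\mathrm{p.v.}\int_{\mathbb{R}}\frac{g(y)}{x-y}dy$ is the Hilbert transform. $X\hat\otimes_\pi Y$ denotes the completion of the algebraic tensor product $X\otimes Y$ in the projective norm $\|u\|_\pi=\inf\{\sum_{i=1}^n\|x_i\|\|y_i\| : u=\sum_{i=1}^n x_i\otimes y_i\}$. A Banach lattice of measurable functions $E$ is a Banach space of (a.e. classes of) measurable functions such that if $h\in E$, $g$ is measurable and $|g|\le|h|$ a.e., then $g\in E$ and $\|g\|_E\le\|h\|_E$. The operator $\mathbf{K}$ is $$(\mathbf{K}f)(x_1,x_2)=\frac1\pi\int_{\mathbb{R}}\int_{\mathbb{R}}\frac{f(y_1,y_2)}{x_1y_2-x_2y_1}dy_1dy_2,$$ with the Cauchy principal value applied to each integral. For $f=f_1\otimes f_2$, i.e. $f(y_1,y_2)=f_1(y_1)f_2(y_2)$, this is understood (for $x_1,x_2\neq0$) as the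 iterated integral $\frac1\pi\int_{\mathbb{R}}f_1(y_1)\left(\int_{\mathbb{R}}\frac{f_2(y_2)}{x_1y_2-x_2y_1}dy_2\right)dy_1$; $\mathbf{K}$ is extended linearly to the algebraic tensor product, and to the projective tensor product by continuity. *)

theory Defs
  imports "HOL-Probability.Essential_Supremum"
begin

section \<open>Classes of measurable functions modulo equality almost everywhere\<close>

definition ae_eq :: "('a::euclidean_space \<Rightarrow> real) \<Rightarrow> ('a \<Rightarrow> real) \<Rightarrow> bool" where
  "ae_eq f g \<longleftrightarrow> f \<in> borel_measurable lebesgue \<and> g \<in> borel_measurable lebesgue \<and>
     (AE x in lebesgue. f x = g x)"

quotient_type (overloaded) 'a L0 = "'a::euclidean_space \<Rightarrow> real" / partial: ae_eq
  morphisms rep L0_of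
proof (rule part_equivpI)
  show "\<exists>x. ae_eq (x :: 'a \<Rightarrow> real) x"
    by (rule exI[of _ "\<lambda>_. 0"]) (simp add: ae_eq_def)
  show "symp (ae_eq :: ('a \<Rightarrow> real) \<Rightarrow> _)"
    by (auto intro!: sympI simp: ae_eq_def)
  show "transp (ae_eq :: ('a \<Rightarrow> real) \<Rightarrow> _)"
  proof (rule transpI)
    fix f g h :: "'a \<Rightarrow> real"
    assume "ae_eq f g" "ae_eq g h"
    then have fg: "AE x in lebesgue. f x = g x" and gh: "AE x in lebesgue. g x = h x"
      and "f \<in> borel_measurable lebesgue" "h \<in> borel_measurable lebesgue"
      by (auto simp: ae_eq_def)
    moreover have "AE x in lebesgue. f x = h x"
      using fg gh by eventually_elim simp
    ultimately show "ae_eq f h" by (simp add: ae_eq_def)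
  qed
qed

lemma rep_L0_of:
  assumes "f \<in> borel_measurable lebesgue"
  shows "ae_eq (rep (L0_of f)) f"
  using Quotient3_rep_abs[OF Quotient3_L0, of f] assms by (simp add: ae_eq_def)

lemma ae_eq_rep: "ae_eq (rep f) (rep f)"
  using Quotient3_rep_reflp[OF Quotient3_L0] .

lemma L0_of_rep [simp]: "L0_of (rep f) = f"
  using Quotient3_abs_rep[OF Quotient3_L0] .

lemma rep_measurable [measurable]: "rep f \<in> borel_measurable lebesgue"
  using ae_eq_rep[of f] by (simp add: ae_eq_def)

lemma AE_rep_L0_of:
  "f \<in> borel_measurable lebesgue \<Longrightarrow> AE x in lebesgue. rep (L0_of f) x = f x"
  using rep_L0_of by (auto simp: ae_eq_def)

lemma L0_eqI:
  assumes "AE x in lebesgue. rep f x = rep g x"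
  shows "f = g"
proof -
  have "ae_eq (rep f) (rep g)" using assms by (simp add: ae_eq_def)
  then have "L0_of (rep f) = L0_of (rep g)"
    using Quotient3_rel_abs[OF Quotient3_L0] by blast
  then show ?thesis by simp
qed

instantiation L0 :: (euclidean_space) real_vector
begin

definition "0 = L0_of (\<lambda>_. 0)"
definition "f + g = L0_of (\<lambda>x. rep f x + rep g x)"
definition "f - g = L0_of (\<lambda>x. rep f x - rep g x)"
definition "- f = L0_of (\<lambda>x. - rep f x)"
definition "c *\<^sub>R f = L0_of (\<lambda>x. c * rep f x)"

lemma AE_rep_zero: "AE x in lebesgue. rep (0 :: 'a L0) x = 0"
  unfolding zero_L0_def by (rule AE_rep_L0_of) simp

lemma AE_rep_add: "AE x in lebesgue. rep (f + g :: 'a L0) x = rep f x + rep g x"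
  unfolding plus_L0_def by (rule AE_rep_L0_of) measurable

lemma AE_rep_diff: "AE x in lebesgue. rep (f - g :: 'a L0) x = rep f x - rep g x"
  unfolding minus_L0_def by (rule AE_rep_L0_of) measurable

lemma AE_rep_uminus: "AE x in lebesgue. rep (- f :: 'a L0) x = - rep f x"
  unfolding uminus_L0_def by (rule AE_rep_L0_of) measurable

lemma AE_rep_scaleR: "AE x in lebesgue. rep (c *\<^sub>R f :: 'a L0) x = c * rep f x"
  unfolding scaleR_L0_def by (rule AE_rep_L0_of) measurable

instance
proof
  fix f g h :: "'a L0" and a b :: real
  show "f + g + h = f + (g + h)"
    using AE_rep_add[of "f + g" h] AE_rep_add[of f g] AE_rep_add[of f "g + h"] AE_rep_add[of g h]
    by (intro L0_eqI, eventually_elim) simp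
  show "f + g = g + f"
    using AE_rep_add[of f g] AE_rep_add[of g f] by (intro L0_eqI, eventually_elim) simp
  show "0 + f = f"
    using AE_rep_add[of 0 f] AE_rep_zero by (intro L0_eqI, eventually_elim) simp
  show "- f + f = 0"
    using AE_rep_add[of "- f" f] AE_rep_uminus[of f] AE_rep_zero
    by (intro L0_eqI, eventually_elim) simp
  show "f - g = f + - g"
    using AE_rep_add[of f "- g"] AE_rep_uminus[of g] AE_rep_diff[of f g]
    by (intro L0_eqI, eventually_elim) simp
  show "a *\<^sub>R (f + g) = a *\<^sub>R f + a *\<^sub>R g"
    using AE_rep_scaleR[of a "f + g"] AE_rep_add[of f g] AE_rep_add[of "a *\<^sub>R f" "a *\<^sub>R g"]
      AE_rep_scaleR[of a f] AE_rep_scaleR[of a g]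
    by (intro L0_eqI, eventually_elim) (simp add: algebra_simps)
  show "(a + b) *\<^sub>R f = a *\<^sub>R f + b *\<^sub>R f"
    using AE_rep_scaleR[of "a + b" f] AE_rep_add[of "a *\<^sub>R f" "b *\<^sub>R f"]
      AE_rep_scaleR[of a f] AE_rep_scaleR[of b f]
    by (intro L0_eqI, eventually_elim) (simp add: algebra_simps)
  show "a *\<^sub>R b *\<^sub>R f = (a * b) *\<^sub>R f"
    using AE_rep_scaleR[of a "b *\<^sub>R f"] AE_rep_scaleR[of "a * b" f] AE_rep_scaleR[of b f]
    by (intro L0_eqI, eventually_elim) simp
  show "1 *\<^sub>R f = f"
    using AE_rep_scaleR[of 1 f] by (intro L0_eqI, eventually_elim) simp
qed

end


section \<open>Banach lattices of measurable functions\<close>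

locale banach_function_lattice =
  fixes E :: "'a::euclidean_space L0 set" and N :: "'a L0 \<Rightarrow> real"
  assumes subspace_E: "subspace E"
    and N_nonneg: "f \<in> E \<Longrightarrow> 0 \<le> N f"
    and N_eq_zero: "f \<in> E \<Longrightarrow> N f = 0 \<longleftrightarrow> f = 0"
    and N_triangle: "f \<in> E \<Longrightarrow> g \<in> E \<Longrightarrow> N (f + g) \<le> N f + N g"
    and N_scaleR: "f \<in> E \<Longrightarrow> N (c *\<^sub>R f) = \<bar>c\<bar> * N f"
    and complete_E: "(\<And>n. F n \<in> E) \<Longrightarrow>
      (\<And>e. e > 0 \<Longrightarrow> \<exists>M. \<forall>m\<ge>M. \<forall>n\<ge>M. N (F m - F n) < e) \<Longrightarrow>
      \<exists>f\<in>E. (\<lambda>n. N (F n - f)) \<longlonglongrightarrow> 0"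
    and ideal_E: "h \<in> E \<Longrightarrow> AE x in lebesgue. \<bar>rep g x\<bar> \<le> \<bar>rep h x\<bar> \<Longrightarrow> g \<in> E"
    and N_mono: "h \<in> E \<Longrightarrow> AE x in lebesgue. \<bar>rep g x\<bar> \<le> \<bar>rep h x\<bar> \<Longrightarrow> N g \<le> N h"

text \<open>Linear operators from a normed space into such a lattice, which is a set rather than a type;
  the operator norm follows the library's \<open>onorm\<close>.\<close>

definition bounded_linear_into ::
  "'b::euclidean_space L0 set \<Rightarrow> ('b L0 \<Rightarrow> real) \<Rightarrow> ('a::real_normed_vector \<Rightarrow> 'b L0) \<Rightarrow> bool" where
  "bounded_linear_into E N T \<longleftrightarrow>
     linear T \<and> (\<forall>u. T u \<in> E) \<and> (\<exists>C. \<forall>u. N (T u) \<le> C * norm u)"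

definition operator_norm ::
  "('b::euclidean_space L0 \<Rightarrow> real) \<Rightarrow> ('a::real_normed_vector \<Rightarrow> 'b L0) \<Rightarrow> real" where
  "operator_norm N T = (SUP u. N (T u) / norm u)"


section \<open>The space of essentially bounded functions on the line\<close>

typedef (overloaded) Linf = "{f :: real L0. esssup lebesgue (\<lambda>x. ereal \<bar>rep f x\<bar>) < \<infinity>}"
  morphisms fun_Linf Abs_Linf
proof
  have "AE x in lebesgue. ereal \<bar>rep (0 :: real L0) x\<bar> \<le> 0"
    using AE_rep_zero by eventually_elim simp
  then have "esssup lebesgue (\<lambda>x. ereal \<bar>rep (0 :: real L0) x\<bar>) \<le> 0"
    by (intro esssup_I) auto
  then show "0 \<in> {f :: real L0. esssup lebesgue (\<lambda>x. ereal \<bar>rep f x\<bar>) < \<infinity>}"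
    by auto
qed

setup_lifting type_definition_Linf

lemma esssup_le_iff:
  "esssup lebesgue (\<lambda>x. ereal \<bar>rep (f :: real L0) x\<bar>) \<le> ereal c \<longleftrightarrow>
     (AE x in lebesgue. \<bar>rep f x\<bar> \<le> c)"
proof
  assume *: "esssup lebesgue (\<lambda>x. ereal \<bar>rep f x\<bar>) \<le> ereal c"
  have "AE x in lebesgue. ereal \<bar>rep f x\<bar> \<le> esssup lebesgue (\<lambda>x. ereal \<bar>rep f x\<bar>)"
    by (rule esssup_AE)
  then show "AE x in lebesgue. \<bar>rep f x\<bar> \<le> c"
    by eventually_elim (use * order_trans in fastforce)
next
  assume "AE x in lebesgue. \<bar>rep f x\<bar> \<le> c"
  then show "esssup lebesgue (\<lambda>x. ereal \<bar>rep f x\<bar>) \<le> ereal c"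
    by (intro esssup_I) auto
qed

lemma esssup_abs_nonneg: "0 \<le> esssup lebesgue (\<lambda>x. ereal \<bar>rep (f :: real L0) x\<bar>)"
proof -
  have "esssup lebesgue (\<lambda>x::real. 0 :: ereal) \<le> esssup lebesgue (\<lambda>x. ereal \<bar>rep f x\<bar>)"
    by (rule esssup_mono) auto
  then show ?thesis by (simp add: esssup_const)
qed

lemma esssup_finite_iff:
  "esssup lebesgue (\<lambda>x. ereal \<bar>rep (f :: real L0) x\<bar>) < \<infinity> \<longleftrightarrow>
     (\<exists>c. AE x in lebesgue. \<bar>rep f x\<bar> \<le> c)"
proof
  assume *: "esssup lebesgue (\<lambda>x. ereal \<bar>rep f x\<bar>) < \<infinity>"
  show "\<exists>c. AE x in lebesgue. \<bar>rep f x\<bar> \<le> c"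
    unfolding esssup_le_iff[symmetric]
  proof
    show "esssup lebesgue (\<lambda>x. ereal \<bar>rep f x\<bar>) \<le>
        ereal (real_of_ereal (esssup lebesgue (\<lambda>x. ereal \<bar>rep f x\<bar>)))"
      using * esssup_abs_nonneg[of f] by (subst ereal_real') auto
  qed
next
  assume "\<exists>c. AE x in lebesgue. \<bar>rep f x\<bar> \<le> c"
  then obtain c where "esssup lebesgue (\<lambda>x. ereal \<bar>rep f x\<bar>) \<le> ereal c"
    unfolding esssup_le_iff[symmetric] by blast
  also have "\<dots> < \<infinity>" by simp
  finally show "esssup lebesgue (\<lambda>x. ereal \<bar>rep f x\<bar>) < \<infinity>" .
qed

instantiation Linf :: real_normed_vector
begin

lift_definition zero_Linf :: Linf is 0
  unfolding esssup_finite_iff mem_Collect_eq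
  by (rule exI[of _ 0], rule eventually_mono[OF AE_rep_zero]) simp

lift_definition plus_Linf :: "Linf \<Rightarrow> Linf \<Rightarrow> Linf" is "(+)"
proof -
  fix f g :: "real L0"
  assume "esssup lebesgue (\<lambda>x. ereal \<bar>rep f x\<bar>) < \<infinity>" "esssup lebesgue (\<lambda>x. ereal \<bar>rep g x\<bar>) < \<infinity>"
  then obtain c d where "AE x in lebesgue. \<bar>rep f x\<bar> \<le> c" "AE x in lebesgue. \<bar>rep g x\<bar> \<le> d"
    unfolding esssup_finite_iff by blast
  then have "AE x in lebesgue. \<bar>rep (f + g) x\<bar> \<le> c + d"
    using AE_rep_add[of f g] by eventually_elim auto
  then show "esssup lebesgue (\<lambda>x. ereal \<bar>rep (f + g) x\<bar>) < \<infinity>"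
    unfolding esssup_finite_iff by blast
qed

lift_definition scaleR_Linf :: "real \<Rightarrow> Linf \<Rightarrow> Linf" is "(*\<^sub>R)"
proof -
  fix a and f :: "real L0"
  assume "esssup lebesgue (\<lambda>x. ereal \<bar>rep f x\<bar>) < \<infinity>"
  then obtain c where "AE x in lebesgue. \<bar>rep f x\<bar> \<le> c"
    unfolding esssup_finite_iff by blast
  then have "AE x in lebesgue. \<bar>rep (a *\<^sub>R f) x\<bar> \<le> \<bar>a\<bar> * c"
    using AE_rep_scaleR[of a f] by eventually_elim (auto simp: abs_mult intro: mult_left_mono)
  then show "esssup lebesgue (\<lambda>x. ereal \<bar>rep (a *\<^sub>R f) x\<bar>) < \<infinity>"
    unfolding esssup_finite_iff by blast
qed

definition "- f = (- 1) *\<^sub>R f" for f :: Linf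
definition "f - g = f + - g" for f g :: Linf

lift_definition norm_Linf :: "Linf \<Rightarrow> real" is
  "\<lambda>f. real_of_ereal (esssup lebesgue (\<lambda>x. ereal \<bar>rep f x\<bar>))" .

definition "sgn f = inverse (norm f) *\<^sub>R f" for f :: Linf
definition "dist f g = norm (f - g)" for f g :: Linf
definition
  "(uniformity :: (Linf \<times> Linf) filter) = (INF e\<in>{0 <..}. principal {(x, y). dist x y < e})"
definition
  "open (S :: Linf set) = (\<forall>x\<in>S. \<forall>\<^sub>F (x', y) in uniformity. x' = x \<longrightarrow> y \<in> S)"

lemma ereal_norm_Linf: "ereal (norm f) = esssup lebesgue (\<lambda>x. ereal \<bar>rep (fun_Linf f) x\<bar>)"
proof transfer
  fix f :: "real L0"
  assume "esssup lebesgue (\<lambda>x. ereal \<bar>rep f x\<bar>) < \<infinity>"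
  then show "ereal (real_of_ereal (esssup lebesgue (\<lambda>x. ereal \<bar>rep f x\<bar>))) =
    esssup lebesgue (\<lambda>x. ereal \<bar>rep f x\<bar>)"
    using esssup_abs_nonneg[of f] by (intro ereal_real') auto
qed

lemma norm_Linf_le_iff: "norm f \<le> c \<longleftrightarrow> (AE x in lebesgue. \<bar>rep (fun_Linf f) x\<bar> \<le> c)"
  unfolding esssup_le_iff[symmetric] ereal_norm_Linf[symmetric] by simp

lemma AE_norm_Linf: "AE x in lebesgue. \<bar>rep (fun_Linf f) x\<bar> \<le> norm f"
  using norm_Linf_le_iff[of f "norm f"] by simp

lemma norm_Linf_nonneg: "0 \<le> norm (f :: Linf)"
  using esssup_abs_nonneg[of "fun_Linf f"] unfolding ereal_norm_Linf[symmetric] by simp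

instance
proof
  fix f g h :: Linf and a b :: real
  show "f + g + h = f + (g + h)" by transfer simp
  show "f + g = g + f" by transfer simp
  show "0 + f = f" by transfer simp
  show "- f + f = 0" unfolding uminus_Linf_def by transfer simp
  show "f - g = f + - g" by (simp add: minus_Linf_def)
  show "a *\<^sub>R (f + g) = a *\<^sub>R f + a *\<^sub>R g" by transfer (simp add: scaleR_add_right)
  show "(a + b) *\<^sub>R f = a *\<^sub>R f + b *\<^sub>R f" by transfer (simp add: scaleR_add_left)
  show "a *\<^sub>R b *\<^sub>R f = (a * b) *\<^sub>R f" by transfer simp
  show "1 *\<^sub>R f = f" by transfer simp
  show "sgn f = inverse (norm f) *\<^sub>R f" by (rule sgn_Linf_def)
  show "dist f g = norm (f - g)" by (rule dist_Linf_def)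
  show "(uniformity :: (Linf \<times> Linf) filter) = (INF e\<in>{0 <..}. principal {(x, y). dist x y < e})"
    by (rule uniformity_Linf_def)
  show "open S = (\<forall>x\<in>S. \<forall>\<^sub>F (x', y) in uniformity. x' = x \<longrightarrow> y \<in> S)" for S :: "Linf set"
    by (rule open_Linf_def)
  show "norm f = 0 \<longleftrightarrow> f = 0"
  proof
    assume *: "norm f = 0"
    have "AE x in lebesgue. rep (fun_Linf f) x = rep 0 x"
      using AE_norm_Linf[of f] AE_rep_zero[where 'a=real] by eventually_elim (simp add: *)
    then have "fun_Linf f = 0" by (rule L0_eqI)
    then show "f = 0" by transfer
  next
    assume "f = 0"
    then have "fun_Linf f = 0" by (simp add: zero_Linf.rep_eq)
    then have "norm f \<le> 0"
      unfolding norm_Linf_le_iff by (intro eventually_mono[OF AE_rep_zero[where 'a=real]]) simp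
    then show "norm f = 0" using norm_Linf_nonneg[of f] by simp
  qed
  show "norm (f + g) \<le> norm f + norm g"
    unfolding norm_Linf_le_iff plus_Linf.rep_eq
    using AE_norm_Linf[of f] AE_norm_Linf[of g] AE_rep_add[of "fun_Linf f" "fun_Linf g"]
    by eventually_elim auto
  have le: "norm (a *\<^sub>R f) \<le> \<bar>a\<bar> * norm f" for a and f :: Linf
    unfolding norm_Linf_le_iff scaleR_Linf.rep_eq
    using AE_norm_Linf[of f] AE_rep_scaleR[of a "fun_Linf f"]
    by eventually_elim (auto simp: abs_mult intro: mult_left_mono)
  show "norm (a *\<^sub>R f) = \<bar>a\<bar> * norm f"
  proof (cases "a = 0")
    case True
    then show ?thesis using le[of a f] norm_Linf_nonneg[of "a *\<^sub>R f"] by simp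
  next
    case False
    have "norm f = norm (inverse a *\<^sub>R a *\<^sub>R f)" using False by transfer simp
    also have "\<dots> \<le> \<bar>inverse a\<bar> * norm (a *\<^sub>R f)" by (rule le)
    finally have "\<bar>a\<bar> * norm f \<le> norm (a *\<^sub>R f)"
      using False by (simp add: field_simps)
    then show ?thesis using le[of a f] by simp
  qed
qed

end


section \<open>Principal values and the Hilbert transform\<close>

definition truncated_integral :: "real \<Rightarrow> (real \<Rightarrow> real) \<Rightarrow> real \<Rightarrow> real" where
  "truncated_integral s f \<epsilon> = (LINT y:{y. \<epsilon> < \<bar>y - s\<bar>}|lebesgue. f y)"

definition pv_exists :: "real \<Rightarrow> (real \<Rightarrow> real) \<Rightarrow> bool" where
  "pv_exists s f \<longleftrightarrow> (\<forall>\<epsilon>>0. set_integrable lebesgue {y. \<epsilon> < \<bar>y - s\<bar>} f) \<and>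
     (\<exists>l. (truncated_integral s f \<longlongrightarrow> l) (at_right 0))"

definition pv_integral :: "real \<Rightarrow> (real \<Rightarrow> real) \<Rightarrow> real" where
  "pv_integral s f = Lim (at_right 0) (truncated_integral s f)"

definition hilbert_transform :: "(real \<Rightarrow> real) \<Rightarrow> real \<Rightarrow> real" where
  "hilbert_transform g x = 1 / pi * pv_integral x (\<lambda>y. g y / (x - y))"

lemma pv_integral_eqI: "(truncated_integral s f \<longlongrightarrow> l) (at_right 0) \<Longrightarrow> pv_integral s f = l"
  unfolding pv_integral_def by (intro tendsto_Lim) auto

lemma pv_tendsto:
  "pv_exists s f \<Longrightarrow> (truncated_integral s f \<longlongrightarrow> pv_integral s f) (at_right 0)"
  using pv_integral_eqI unfolding pv_exists_def by blast

lemma sets_truncation [measurable, simp]: "{y. e < \<bar>y - s :: real\<bar>} \<in> sets lebesgue"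
  by (rule sets_completionI_sets) measurable

lemma truncated_integral_cong_AE:
  assumes "f \<in> borel_measurable lebesgue" "g \<in> borel_measurable lebesgue"
    and "AE y in lebesgue. f y = g y"
  shows "truncated_integral s f = truncated_integral s g"
proof
  fix e
  show "truncated_integral s f e = truncated_integral s g e"
    unfolding truncated_integral_def set_lebesgue_integral_def
    by (intro integral_cong_AE borel_measurable_scaleR borel_measurable_indicator
        assms sets_truncation eventually_mono[OF assms(3)]) simp
qed

lemma set_integrable_cong_AE':
  fixes f g :: "real \<Rightarrow> real"
  assumes "f \<in> borel_measurable lebesgue" "g \<in> borel_measurable lebesgue"
    and "AE y in lebesgue. f y = g y" and "A \<in> sets lebesgue"
  shows "set_integrable lebesgue A f \<longleftrightarrow> set_integrable lebesgue A g"
  unfolding set_integrable_def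
  by (intro integrable_cong_AE borel_measurable_scaleR borel_measurable_indicator
      assms eventually_mono[OF assms(3)]) simp

lemma pv_cong_AE:
  assumes "f \<in> borel_measurable lebesgue" "g \<in> borel_measurable lebesgue"
    and "AE y in lebesgue. f y = g y"
  shows "pv_exists s f \<longleftrightarrow> pv_exists s g" and "pv_integral s f = pv_integral s g"
proof -
  show "pv_exists s f \<longleftrightarrow> pv_exists s g" "pv_integral s f = pv_integral s g"
    using set_integrable_cong_AE'[OF assms sets_truncation] truncated_integral_cong_AE[OF assms]
    by (auto simp: pv_exists_def pv_integral_def)
qed

lemma pv_zero: "pv_exists s (\<lambda>_. 0)" "pv_integral s (\<lambda>_. 0) = 0"
proof -
  have "(truncated_integral s (\<lambda>_. 0) \<longlongrightarrow> 0) (at_right 0)"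
    by (simp add: truncated_integral_def[abs_def])
  then show "pv_exists s (\<lambda>_. 0)" "pv_integral s (\<lambda>_. 0) = 0"
    by (auto simp: pv_exists_def set_integrable_def intro: pv_integral_eqI)
qed

lemma pv_add:
  assumes "pv_exists s f" "pv_exists s g"
  shows "pv_exists s (\<lambda>y. f y + g y)"
    and "pv_integral s (\<lambda>y. f y + g y) = pv_integral s f + pv_integral s g"
proof -
  have "((\<lambda>e. truncated_integral s f e + truncated_integral s g e) \<longlongrightarrow>
      pv_integral s f + pv_integral s g) (at_right 0)"
    by (intro tendsto_add pv_tendsto assms)
  moreover have "\<forall>\<^sub>F e in at_right 0. truncated_integral s f e + truncated_integral s g e =
      truncated_integral s (\<lambda>y. f y + g y) e"
    unfolding eventually_at_right_field
    using assms by (auto intro!: exI[of _ 1] simp: pv_exists_def truncated_integral_def)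
  ultimately have *: "(truncated_integral s (\<lambda>y. f y + g y) \<longlongrightarrow>
      pv_integral s f + pv_integral s g) (at_right 0)"
    by (rule Lim_transform_eventually)
  then show "pv_integral s (\<lambda>y. f y + g y) = pv_integral s f + pv_integral s g"
    by (rule pv_integral_eqI)
  show "pv_exists s (\<lambda>y. f y + g y)"
    using * assms by (auto simp: pv_exists_def)
qed

lemma pv_cmult:
  assumes "pv_exists s f"
  shows "pv_exists s (\<lambda>y. c * f y)" and "pv_integral s (\<lambda>y. c * f y) = c * pv_integral s f"
proof -
  have "((\<lambda>e. c * truncated_integral s f e) \<longlongrightarrow> c * pv_integral s f) (at_right 0)"
    by (intro tendsto_mult tendsto_const pv_tendsto assms)
  then have *: "(truncated_integral s (\<lambda>y. c * f y) \<longlongrightarrow> c * pv_integral s f) (at_right 0)"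
    by (simp add: truncated_integral_def[abs_def])
  then show "pv_integral s (\<lambda>y. c * f y) = c * pv_integral s f"
    by (rule pv_integral_eqI)
  show "pv_exists s (\<lambda>y. c * f y)"
    using * assms by (auto simp: pv_exists_def)
qed


section \<open>The real Hardy space on the line\<close>

text \<open>The condition that the Hilbert transform is in \<open>L\<^sup>1\<close> includes that its defining principal
  value exists almost everywhere; the constant \<^const>\<open>pv_integral\<close> alone is a total function.
  For integrable \<open>g\<close> existence is a classical theorem, so this does not restrict the space.\<close>

definition hardy :: "real L0 \<Rightarrow> bool" where
  "hardy g \<longleftrightarrow> integrable lebesgue (rep g) \<and>
     (AE x in lebesgue. pv_exists x (\<lambda>y. rep g y / (x - y))) \<and>
     integrable lebesgue (hilbert_transform (rep g))"

definition hardy_norm :: "real L0 \<Rightarrow> real" where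
  "hardy_norm g = (LINT x|lebesgue. \<bar>rep g x\<bar>) + (LINT x|lebesgue. \<bar>hilbert_transform (rep g) x\<bar>)"

lemma measurable_kernel [measurable, simp]:
  "f \<in> borel_measurable lebesgue \<Longrightarrow> (\<lambda>y. f y / (x - y :: real)) \<in> borel_measurable lebesgue"
  by (rule borel_measurable_divide, assumption, rule measurable_completion) simp

lemma pv_rep_zero:
  "pv_exists x (\<lambda>y. rep (0 :: real L0) y / (x - y))" "hilbert_transform (rep (0 :: real L0)) x = 0"
proof -
  have *: "AE y in lebesgue. rep (0 :: real L0) y / (x - y) = 0"
    using AE_rep_zero[where 'a=real] by eventually_elim simp
  show "pv_exists x (\<lambda>y. rep (0 :: real L0) y / (x - y))"
    using pv_cong_AE(1)[OF _ _ *, of x] pv_zero by simp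
  show "hilbert_transform (rep (0 :: real L0)) x = 0"
    using pv_cong_AE(2)[OF _ _ *, of x] pv_zero by (simp add: hilbert_transform_def)
qed

lemma pv_rep_add:
  fixes f g :: "real L0"
  assumes "pv_exists x (\<lambda>y. rep f y / (x - y))" "pv_exists x (\<lambda>y. rep g y / (x - y))"
  shows "pv_exists x (\<lambda>y. rep (f + g) y / (x - y))"
    and "hilbert_transform (rep (f + g)) x = hilbert_transform (rep f) x + hilbert_transform (rep g) x"
proof -
  have *: "AE y in lebesgue. rep (f + g) y / (x - y) = rep f y / (x - y) + rep g y / (x - y)"
    using AE_rep_add[of f g] by eventually_elim (simp add: add_divide_distrib)
  show "pv_exists x (\<lambda>y. rep (f + g) y / (x - y))"
    using pv_cong_AE(1)[OF _ _ *, of x] pv_add[OF assms] by simp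
  show "hilbert_transform (rep (f + g)) x = hilbert_transform (rep f) x + hilbert_transform (rep g) x"
    using pv_cong_AE(2)[OF _ _ *, of x] pv_add[OF assms]
    by (simp add: hilbert_transform_def add_divide_distrib)
qed

lemma pv_rep_scaleR:
  fixes f :: "real L0"
  assumes "pv_exists x (\<lambda>y. rep f y / (x - y))"
  shows "pv_exists x (\<lambda>y. rep (c *\<^sub>R f) y / (x - y))"
    and "hilbert_transform (rep (c *\<^sub>R f)) x = c * hilbert_transform (rep f) x"
proof -
  have *: "AE y in lebesgue. rep (c *\<^sub>R f) y / (x - y) = c * (rep f y / (x - y))"
    using AE_rep_scaleR[of c f] by eventually_elim simp
  show "pv_exists x (\<lambda>y. rep (c *\<^sub>R f) y / (x - y))"
    using pv_cong_AE(1)[OF _ _ *, of x] pv_cmult[OF assms, of c] by simp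
  show "hilbert_transform (rep (c *\<^sub>R f)) x = c * hilbert_transform (rep f) x"
    using pv_cong_AE(2)[OF _ _ *, of x] pv_cmult[OF assms, of c]
    by (simp add: hilbert_transform_def)
qed

lemma integrable_lebesgue_cong_AE:
  fixes f g :: "real \<Rightarrow> real"
  assumes g: "integrable lebesgue g" and eq: "AE x in lebesgue. f x = g x"
  shows "integrable lebesgue f"
proof -
  have "f \<in> borel_measurable lebesgue"
    by (rule borel_measurable_AE[OF borel_measurable_integrable[OF g] eventually_mono[OF eq]]) simp
  then show ?thesis
    using integrable_cong_AE[of f lebesgue g] g eq by auto
qed

lemma hardy_zero: "hardy 0"
proof -
  have "hilbert_transform (rep (0 :: real L0)) = (\<lambda>_. 0)" by (simp add: fun_eq_iff pv_rep_zero)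
  then show ?thesis
    using integrable_lebesgue_cong_AE[of "\<lambda>_. 0" "rep 0", OF _ AE_rep_zero]
    by (simp add: hardy_def pv_rep_zero)
qed

lemma AE_hilbert_add:
  assumes "hardy f" "hardy g"
  shows "AE x in lebesgue. hilbert_transform (rep (f + g)) x =
    hilbert_transform (rep f) x + hilbert_transform (rep g) x"
proof -
  have "AE x in lebesgue. pv_exists x (\<lambda>y. rep f y / (x - y))"
    "AE x in lebesgue. pv_exists x (\<lambda>y. rep g y / (x - y))"
    using assms by (auto simp: hardy_def)
  then show ?thesis by eventually_elim (rule pv_rep_add)
qed

lemma AE_hilbert_scaleR:
  assumes "hardy f"
  shows "AE x in lebesgue. hilbert_transform (rep (c *\<^sub>R f)) x = c * hilbert_transform (rep f) x"
proof -
  have "AE x in lebesgue. pv_exists x (\<lambda>y. rep f y / (x - y))"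
    using assms by (auto simp: hardy_def)
  then show ?thesis by eventually_elim (rule pv_rep_scaleR)
qed

lemma hardy_add:
  assumes "hardy f" "hardy g"
  shows "hardy (f + g)"
proof -
  have "AE x in lebesgue. pv_exists x (\<lambda>y. rep f y / (x - y))"
    "AE x in lebesgue. pv_exists x (\<lambda>y. rep g y / (x - y))"
    using assms by (auto simp: hardy_def)
  then have "AE x in lebesgue. pv_exists x (\<lambda>y. rep (f + g) y / (x - y))"
    by eventually_elim (rule pv_rep_add)
  moreover have "integrable lebesgue (rep (f + g))"
    using assms by (intro integrable_lebesgue_cong_AE[OF _ AE_rep_add]) (auto simp: hardy_def)
  moreover have "integrable lebesgue (hilbert_transform (rep (f + g)))"
    using assms by (intro integrable_lebesgue_cong_AE[OF _ AE_hilbert_add]) (auto simp: hardy_def)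
  ultimately show ?thesis by (simp add: hardy_def)
qed

lemma hardy_scaleR:
  assumes "hardy f"
  shows "hardy (c *\<^sub>R f)"
proof -
  have "AE x in lebesgue. pv_exists x (\<lambda>y. rep f y / (x - y))"
    using assms by (auto simp: hardy_def)
  then have "AE x in lebesgue. pv_exists x (\<lambda>y. rep (c *\<^sub>R f) y / (x - y))"
    by eventually_elim (rule pv_rep_scaleR)
  moreover have "integrable lebesgue (rep (c *\<^sub>R f))"
    using assms by (intro integrable_lebesgue_cong_AE[OF _ AE_rep_scaleR]) (auto simp: hardy_def)
  moreover have "integrable lebesgue (hilbert_transform (rep (c *\<^sub>R f)))"
    using assms by (intro integrable_lebesgue_cong_AE[OF _ AE_hilbert_scaleR]) (auto simp: hardy_def)
  ultimately show ?thesis by (simp add: hardy_def)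
qed

lemma integral_abs_triangle:
  fixes f g h :: "real \<Rightarrow> real"
  assumes "integrable lebesgue f" "integrable lebesgue g" "integrable lebesgue h"
    and "AE x in lebesgue. h x = f x + g x"
  shows "(LINT x|lebesgue. \<bar>h x\<bar>) \<le> (LINT x|lebesgue. \<bar>f x\<bar>) + (LINT x|lebesgue. \<bar>g x\<bar>)"
proof -
  have "(LINT x|lebesgue. \<bar>h x\<bar>) \<le> (LINT x|lebesgue. \<bar>f x\<bar> + \<bar>g x\<bar>)"
    by (intro integral_mono_AE Bochner_Integration.integrable_add integrable_abs assms(1-3)
        eventually_mono[OF assms(4)]) simp
  then show ?thesis using assms by simp
qed

lemma integral_abs_cmult:
  fixes f h :: "real \<Rightarrow> real"
  assumes "integrable lebesgue f" "integrable lebesgue h"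
    and "AE x in lebesgue. h x = c * f x"
  shows "(LINT x|lebesgue. \<bar>h x\<bar>) = \<bar>c\<bar> * (LINT x|lebesgue. \<bar>f x\<bar>)"
proof -
  have "(LINT x|lebesgue. \<bar>h x\<bar>) = (LINT x|lebesgue. \<bar>c\<bar> * \<bar>f x\<bar>)"
    using assms(1,2)
    by (intro integral_cong_AE eventually_mono[OF assms(3)]) (simp_all add: abs_mult)
  then show ?thesis by simp
qed

lemma hardy_norm_add:
  assumes "hardy f" "hardy g"
  shows "hardy_norm (f + g) \<le> hardy_norm f + hardy_norm g"
proof -
  have "(LINT x|lebesgue. \<bar>rep (f + g) x\<bar>) \<le>
      (LINT x|lebesgue. \<bar>rep f x\<bar>) + (LINT x|lebesgue. \<bar>rep g x\<bar>)"
    using assms hardy_add[OF assms] by (intro integral_abs_triangle AE_rep_add) (auto simp: hardy_def)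
  moreover have "(LINT x|lebesgue. \<bar>hilbert_transform (rep (f + g)) x\<bar>) \<le>
      (LINT x|lebesgue. \<bar>hilbert_transform (rep f) x\<bar>) +
      (LINT x|lebesgue. \<bar>hilbert_transform (rep g) x\<bar>)"
    using assms hardy_add[OF assms]
    by (intro integral_abs_triangle AE_hilbert_add) (auto simp: hardy_def)
  ultimately show ?thesis by (simp add: hardy_norm_def)
qed

lemma hardy_norm_scaleR:
  assumes "hardy f"
  shows "hardy_norm (c *\<^sub>R f) = \<bar>c\<bar> * hardy_norm f"
proof -
  have "(LINT x|lebesgue. \<bar>rep (c *\<^sub>R f) x\<bar>) = \<bar>c\<bar> * (LINT x|lebesgue. \<bar>rep f x\<bar>)"
    using assms hardy_scaleR[OF assms, of c]
    by (intro integral_abs_cmult AE_rep_scaleR) (auto simp: hardy_def)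
  moreover have "(LINT x|lebesgue. \<bar>hilbert_transform (rep (c *\<^sub>R f)) x\<bar>) =
      \<bar>c\<bar> * (LINT x|lebesgue. \<bar>hilbert_transform (rep f) x\<bar>)"
    using assms hardy_scaleR[OF assms, of c]
    by (intro integral_abs_cmult AE_hilbert_scaleR) (auto simp: hardy_def)
  ultimately show ?thesis by (simp add: hardy_norm_def algebra_simps)
qed

lemma hardy_norm_eq_zero:
  assumes "hardy f"
  shows "hardy_norm f = 0 \<longleftrightarrow> f = 0"
proof
  have nn: "0 \<le> (LINT x|lebesgue. \<bar>rep f x\<bar>)"
    "0 \<le> (LINT x|lebesgue. \<bar>hilbert_transform (rep f) x\<bar>)"
    by simp_all
  assume "hardy_norm f = 0"
  then have "(LINT x|lebesgue. \<bar>rep f x\<bar>) = 0"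
    using nn unfolding hardy_norm_def by linarith
  then have "AE x in lebesgue. \<bar>rep f x\<bar> = 0"
    using assms by (subst (asm) integral_nonneg_eq_0_iff_AE) (auto simp: hardy_def)
  then have "AE x in lebesgue. rep f x = rep 0 x"
    using AE_rep_zero[where 'a=real] by eventually_elim simp
  then show "f = 0" by (rule L0_eqI)
next
  assume "f = 0"
  then show "hardy_norm f = 0"
    using hardy_norm_scaleR[OF assms, of 0] by simp
qed

typedef (overloaded) H1 = "{g. hardy g}"
  morphisms fun_H1 Abs_H1
  using hardy_zero by blast

setup_lifting type_definition_H1

instantiation H1 :: real_normed_vector
begin

lift_definition zero_H1 :: H1 is 0 by (rule hardy_zero)
lift_definition plus_H1 :: "H1 \<Rightarrow> H1 \<Rightarrow> H1" is "(+)" by (rule hardy_add)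
lift_definition scaleR_H1 :: "real \<Rightarrow> H1 \<Rightarrow> H1" is "(*\<^sub>R)" by (rule hardy_scaleR)
definition "- f = (- 1) *\<^sub>R f" for f :: H1
definition "f - g = f + - g" for f g :: H1
lift_definition norm_H1 :: "H1 \<Rightarrow> real" is hardy_norm .
definition "sgn f = inverse (norm f) *\<^sub>R f" for f :: H1
definition "dist f g = norm (f - g)" for f g :: H1
definition
  "(uniformity :: (H1 \<times> H1) filter) = (INF e\<in>{0 <..}. principal {(x, y). dist x y < e})"
definition
  "open (S :: H1 set) = (\<forall>x\<in>S. \<forall>\<^sub>F (x', y) in uniformity. x' = x \<longrightarrow> y \<in> S)"

instance
proof
  fix f g h :: H1 and a b :: real
  show "f + g + h = f + (g + h)" by transfer simp
  show "f + g = g + f" by transfer simp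
  show "0 + f = f" by transfer simp
  show "- f + f = 0" unfolding uminus_H1_def by transfer simp
  show "f - g = f + - g" by (simp add: minus_H1_def)
  show "a *\<^sub>R (f + g) = a *\<^sub>R f + a *\<^sub>R g" by transfer (simp add: scaleR_add_right)
  show "(a + b) *\<^sub>R f = a *\<^sub>R f + b *\<^sub>R f" by transfer (simp add: scaleR_add_left)
  show "a *\<^sub>R b *\<^sub>R f = (a * b) *\<^sub>R f" by transfer simp
  show "1 *\<^sub>R f = f" by transfer simp
  show "sgn f = inverse (norm f) *\<^sub>R f" by (rule sgn_H1_def)
  show "dist f g = norm (f - g)" by (rule dist_H1_def)
  show "(uniformity :: (H1 \<times> H1) filter) = (INF e\<in>{0 <..}. principal {(x, y). dist x y < e})"
    by (rule uniformity_H1_def)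
  show "open S = (\<forall>x\<in>S. \<forall>\<^sub>F (x', y) in uniformity. x' = x \<longrightarrow> y \<in> S)" for S :: "H1 set"
    by (rule open_H1_def)
  show "norm f = 0 \<longleftrightarrow> f = 0" by transfer (rule hardy_norm_eq_zero)
  show "norm (f + g) \<le> norm f + norm g" by transfer (rule hardy_norm_add)
  show "norm (a *\<^sub>R f) = \<bar>a\<bar> * norm f" by transfer (rule hardy_norm_scaleR)
qed

end


section \<open>The algebraic tensor product and the projective norm\<close>

text \<open>The algebraic tensor product of two real vector spaces, realised as the space of linear
  functionals on the bilinear forms that is spanned by the evaluations
  \<open>x \<otimes> y = (\<lambda>B. B x y)\<close>. Functionals are given the value 0 outside the bilinear forms, so that
  equality of functions is equality of functionals.\<close>

definition eval_forms :: "('a::real_vector \<times> 'b::real_vector) list \<Rightarrow> ('a \<Rightarrow> 'b \<Rightarrow> real) \<Rightarrow> real" where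
  "eval_forms ps = (\<lambda>B. if bilinear B then (\<Sum>(x, y)\<leftarrow>ps. B x y) else 0)"

typedef (overloaded) ('a, 'b) tensor =
  "range (eval_forms :: ('a::real_vector \<times> 'b::real_vector) list \<Rightarrow> _)"
  by blast

setup_lifting type_definition_tensor

instantiation tensor :: (real_vector, real_vector) real_vector
begin

lift_definition zero_tensor :: "('a, 'b) tensor" is "\<lambda>_. 0"
  by (rule range_eqI[of _ _ "[]"]) (simp add: eval_forms_def fun_eq_iff)

lift_definition plus_tensor :: "('a, 'b) tensor \<Rightarrow> ('a, 'b) tensor \<Rightarrow> ('a, 'b) tensor"
  is "\<lambda>u v B. u B + v B"
proof -
  fix u v :: "('a \<Rightarrow> 'b \<Rightarrow> real) \<Rightarrow> real"
  assume "u \<in> range eval_forms" "v \<in> range eval_forms"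
  then obtain ps qs where "u = eval_forms ps" "v = eval_forms qs" by blast
  then have "(\<lambda>B. u B + v B) = eval_forms (ps @ qs)"
    by (simp add: eval_forms_def fun_eq_iff)
  then show "(\<lambda>B. u B + v B) \<in> range eval_forms" by blast
qed

lift_definition scaleR_tensor :: "real \<Rightarrow> ('a, 'b) tensor \<Rightarrow> ('a, 'b) tensor"
  is "\<lambda>c u B. c * u B"
proof -
  fix c and u :: "('a \<Rightarrow> 'b \<Rightarrow> real) \<Rightarrow> real"
  assume "u \<in> range eval_forms"
  then obtain ps where ps: "u = eval_forms ps" by blast
  have "(\<Sum>(x, y)\<leftarrow>map (\<lambda>(x, y). (c *\<^sub>R x, y)) ps. B x y) = c * (\<Sum>(x, y)\<leftarrow>ps. B x y)"
    if "bilinear B" for B :: "'a \<Rightarrow> 'b \<Rightarrow> real"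
    by (induction ps) (auto simp: bilinear_lmul[OF that] distrib_left)
  then have "(\<lambda>B. c * u B) = eval_forms (map (\<lambda>(x, y). (c *\<^sub>R x, y)) ps)"
    unfolding ps eval_forms_def by (auto simp: fun_eq_iff)
  then show "(\<lambda>B. c * u B) \<in> range eval_forms" by blast
qed

definition "- u = (- 1) *\<^sub>R u" for u :: "('a, 'b) tensor"
definition "u - v = u + - v" for u v :: "('a, 'b) tensor"

instance
proof
  fix u v w :: "('a, 'b) tensor" and a b :: real
  show "u + v + w = u + (v + w)" by transfer (simp add: add.assoc)
  show "u + v = v + u" by transfer (simp add: add.commute)
  show "0 + u = u" by transfer simp
  show "- u + u = 0" unfolding uminus_tensor_def by transfer simp
  show "u - v = u + - v" by (rule minus_tensor_def)
  show "a *\<^sub>R (u + v) = a *\<^sub>R u + a *\<^sub>R v" by transfer (simp add: distrib_left)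
  show "(a + b) *\<^sub>R u = a *\<^sub>R u + b *\<^sub>R u" by transfer (simp add: distrib_right)
  show "a *\<^sub>R b *\<^sub>R u = (a * b) *\<^sub>R u" by transfer (simp add: mult.assoc)
  show "1 *\<^sub>R u = u" by transfer simp
qed

end

lift_definition elem_tensor :: "'a::real_vector \<Rightarrow> 'b::real_vector \<Rightarrow> ('a, 'b) tensor" (infixl "\<otimes>" 70)
  is "\<lambda>x y. eval_forms [(x, y)]" by blast

lemma tensor_bilinear: "bilinear ((\<otimes>) :: 'a::real_vector \<Rightarrow> 'b::real_vector \<Rightarrow> ('a, 'b) tensor)"
  unfolding bilinear_def
  by (intro conjI allI linearI; transfer)
     (auto simp: eval_forms_def fun_eq_iff bilinear_ladd bilinear_radd bilinear_lmul bilinear_rmul)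

lemma sum_elem_tensor:
  "(\<Sum>(x, y)\<leftarrow>ps. x \<otimes> y) = Abs_tensor (eval_forms (ps :: ('a::real_vector \<times> 'b::real_vector) list))"
proof (induction ps)
  case Nil
  have "eval_forms [] = (\<lambda>_ :: 'a \<Rightarrow> 'b \<Rightarrow> real. 0)" by (simp add: eval_forms_def fun_eq_iff)
  then show ?case by (simp add: zero_tensor_def)
next
  case (Cons p ps)
  have "Rep_tensor (Abs_tensor (eval_forms ps)) = eval_forms ps"
    by (rule Abs_tensor_inverse) blast
  then have "Rep_tensor (fst p \<otimes> snd p + Abs_tensor (eval_forms ps)) = eval_forms (p # ps)"
    by (simp add: plus_tensor.rep_eq elem_tensor.rep_eq)
       (simp add: eval_forms_def fun_eq_iff case_prod_unfold)
  then have "fst p \<otimes> snd p + Abs_tensor (eval_forms ps) = Abs_tensor (eval_forms (p # ps))"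
    by (metis Rep_tensor_inverse)
  then show ?case using Cons.IH by (simp add: case_prod_unfold)
qed

lemma tensor_repr:
  obtains ps where "(u :: ('a::real_vector, 'b::real_vector) tensor) = (\<Sum>(x, y)\<leftarrow>ps. x \<otimes> y)"
  using Rep_tensor[of u] Rep_tensor_inverse[of u] sum_elem_tensor by (metis imageE)

definition proj_norm :: "('a::real_normed_vector, 'b::real_normed_vector) tensor \<Rightarrow> real" where
  "proj_norm u = Inf {(\<Sum>(x, y)\<leftarrow>ps. norm x * norm y) | ps. u = (\<Sum>(x, y)\<leftarrow>ps. x \<otimes> y)}"

lemma sum_norms_nonneg: "0 \<le> (\<Sum>(x, y)\<leftarrow>ps. norm x * norm y)"
  by (rule sum_list_nonneg) auto

lemma proj_norm_le: "u = (\<Sum>(x, y)\<leftarrow>ps. x \<otimes> y) \<Longrightarrow> proj_norm u \<le> (\<Sum>(x, y)\<leftarrow>ps. norm x * norm y)"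
  unfolding proj_norm_def
  by (rule cInf_lower) (auto intro!: bdd_belowI[of _ 0] sum_norms_nonneg)

lemma proj_norm_nonneg: "0 \<le> proj_norm u"
proof -
  obtain ps where "u = (\<Sum>(x, y)\<leftarrow>ps. x \<otimes> y)" by (rule tensor_repr)
  then show ?thesis
    unfolding proj_norm_def by (intro cInf_greatest) (auto intro!: sum_norms_nonneg)
qed

lemma proj_norm_approx:
  assumes "proj_norm u < c"
  obtains ps where "u = (\<Sum>(x, y)\<leftarrow>ps. x \<otimes> y)" "(\<Sum>(x, y)\<leftarrow>ps. norm x * norm y) < c"
proof -
  obtain ps where "u = (\<Sum>(x, y)\<leftarrow>ps. x \<otimes> y)" by (rule tensor_repr)
  then have "{(\<Sum>(x, y)\<leftarrow>ps. norm x * norm y) | ps. u = (\<Sum>(x, y)\<leftarrow>ps. x \<otimes> y)} \<noteq> {}" by blast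
  from cInf_lessD[OF this assms[unfolded proj_norm_def]] show ?thesis using that by blast
qed

lemma proj_norm_zero [simp]: "proj_norm 0 = 0"
  by (rule antisym[OF proj_norm_le[of 0 "[]", simplified] proj_norm_nonneg])

lemma proj_norm_triangle: "proj_norm (u + v) \<le> proj_norm u + proj_norm v"
proof (rule field_le_epsilon)
  fix e :: real assume e: "0 < e"
  obtain ps where ps: "u = (\<Sum>(x, y)\<leftarrow>ps. x \<otimes> y)"
      "(\<Sum>(x, y)\<leftarrow>ps. norm x * norm y) < proj_norm u + e / 2"
    using proj_norm_approx[of u "proj_norm u + e / 2"] e by auto
  obtain qs where qs: "v = (\<Sum>(x, y)\<leftarrow>qs. x \<otimes> y)"
      "(\<Sum>(x, y)\<leftarrow>qs. norm x * norm y) < proj_norm v + e / 2"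
    using proj_norm_approx[of v "proj_norm v + e / 2"] e by auto
  have "proj_norm (u + v) \<le> (\<Sum>(x, y)\<leftarrow>ps @ qs. norm x * norm y)"
    by (rule proj_norm_le) (simp add: ps qs)
  then show "proj_norm (u + v) \<le> proj_norm u + proj_norm v + e" using ps qs by simp
qed

lemma proj_norm_scaleR: "proj_norm (c *\<^sub>R u) = \<bar>c\<bar> * proj_norm u"
proof -
  have le: "proj_norm (c *\<^sub>R u) \<le> \<bar>c\<bar> * proj_norm u" if "c \<noteq> 0" for c and u :: "('a, 'b) tensor"
  proof (rule field_le_epsilon)
    fix e :: real assume e: "0 < e"
    obtain ps where ps: "u = (\<Sum>(x, y)\<leftarrow>ps. x \<otimes> y)"
        "(\<Sum>(x, y)\<leftarrow>ps. norm x * norm y) < proj_norm u + e / \<bar>c\<bar>"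
      using proj_norm_approx[of u "proj_norm u + e / \<bar>c\<bar>"] e \<open>c \<noteq> 0\<close> by auto
    let ?qs = "map (\<lambda>(x, y). (c *\<^sub>R x, y)) ps"
    have "(\<Sum>(x, y)\<leftarrow>?qs. x \<otimes> y) = c *\<^sub>R (\<Sum>(x, y)\<leftarrow>ps. x \<otimes> y)"
      by (induction ps) (auto simp: bilinear_lmul[OF tensor_bilinear] scaleR_add_right)
    then have "proj_norm (c *\<^sub>R u) \<le> (\<Sum>(x, y)\<leftarrow>?qs. norm x * norm y)"
      by (intro proj_norm_le) (simp add: ps)
    also have "\<dots> = \<bar>c\<bar> * (\<Sum>(x, y)\<leftarrow>ps. norm x * norm y)"
      by (induction ps) (auto simp: algebra_simps)
    also have "\<dots> \<le> \<bar>c\<bar> * (proj_norm u + e / \<bar>c\<bar>)"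
      using ps by (intro mult_left_mono) auto
    also have "\<dots> = \<bar>c\<bar> * proj_norm u + e" using \<open>c \<noteq> 0\<close> by (simp add: field_simps)
    finally show "proj_norm (c *\<^sub>R u) \<le> \<bar>c\<bar> * proj_norm u + e" .
  qed
  show ?thesis
  proof (cases "c = 0")
    case False
    have "proj_norm u \<le> \<bar>inverse c\<bar> * proj_norm (c *\<^sub>R u)"
      using le[of "inverse c" "c *\<^sub>R u"] False by simp
    then have "\<bar>c\<bar> * proj_norm u \<le> proj_norm (c *\<^sub>R u)" using False by (simp add: field_simps)
    then show ?thesis using le[OF False, of u] by simp
  qed simp
qed

lemma proj_norm_minus: "proj_norm (- u) = proj_norm u"
  using proj_norm_scaleR[of "- 1" u] by simp

lemma proj_norm_diff_commute: "proj_norm (u - v) = proj_norm (v - u)"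
  using proj_norm_minus[of "u - v"] by simp

lemma proj_norm_diff_triangle: "proj_norm (u - w) \<le> proj_norm (u - v) + proj_norm (v - w)"
  using proj_norm_triangle[of "u - v" "v - w"] by simp

lemma proj_norm_abs_diff: "\<bar>proj_norm u - proj_norm v\<bar> \<le> proj_norm (u - v)"
  using proj_norm_triangle[of "u - v" v] proj_norm_triangle[of "v - u" u]
    proj_norm_diff_commute[of u v] by simp


section \<open>The projective tensor product\<close>

text \<open>The completion is the usual space of Cauchy sequences modulo null sequences.\<close>

definition proj_Cauchy ::
  "(nat \<Rightarrow> ('a::real_normed_vector, 'b::real_normed_vector) tensor) \<Rightarrow> bool" where
  "proj_Cauchy u \<longleftrightarrow> (\<forall>e>0. \<exists>M. \<forall>m\<ge>M. \<forall>n\<ge>M. proj_norm (u m - u n) < e)"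

definition proj_equiv ::
  "(nat \<Rightarrow> ('a::real_normed_vector, 'b::real_normed_vector) tensor) \<Rightarrow>
   (nat \<Rightarrow> ('a, 'b) tensor) \<Rightarrow> bool" where
  "proj_equiv u v \<longleftrightarrow> proj_Cauchy u \<and> proj_Cauchy v \<and> (\<lambda>n. proj_norm (u n - v n)) \<longlonglongrightarrow> 0"

lemma proj_Cauchy_const: "proj_Cauchy (\<lambda>_. u)"
  by (simp add: proj_Cauchy_def)

lemma proj_null_squeeze:
  assumes "(\<lambda>n. f n) \<longlonglongrightarrow> (0::real)" "\<And>n. proj_norm (u n) \<le> f n"
  shows "(\<lambda>n. proj_norm (u n)) \<longlonglongrightarrow> 0"
  by (rule tendsto_sandwich[OF _ _ tendsto_const assms(1)]) (simp_all add: assms(2) proj_norm_nonneg)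

quotient_type (overloaded) ('a, 'b) proj_tensor =
  "nat \<Rightarrow> ('a::real_normed_vector, 'b::real_normed_vector) tensor" / partial: proj_equiv
proof (rule part_equivpI)
  show "\<exists>u. proj_equiv u (u :: nat \<Rightarrow> ('a, 'b) tensor)"
    by (rule exI[of _ "\<lambda>_. 0"]) (simp add: proj_equiv_def proj_Cauchy_const)
  show "symp (proj_equiv :: (nat \<Rightarrow> ('a, 'b) tensor) \<Rightarrow> _)"
    by (rule sympI) (simp add: proj_equiv_def proj_norm_diff_commute)
  show "transp (proj_equiv :: (nat \<Rightarrow> ('a, 'b) tensor) \<Rightarrow> _)"
  proof (rule transpI)
    fix u v w :: "nat \<Rightarrow> ('a, 'b) tensor"
    assume *: "proj_equiv u v" "proj_equiv v w"
    then have "(\<lambda>n. proj_norm (u n - v n) + proj_norm (v n - w n)) \<longlonglongrightarrow> 0"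
      using tendsto_add[of "\<lambda>n. proj_norm (u n - v n)" 0 _ "\<lambda>n. proj_norm (v n - w n)" 0]
      by (simp add: proj_equiv_def)
    then have "(\<lambda>n. proj_norm (u n - w n)) \<longlonglongrightarrow> 0"
      by (rule proj_null_squeeze) (rule proj_norm_diff_triangle)
    then show "proj_equiv u w" using * by (simp add: proj_equiv_def)
  qed
qed

lemma proj_Cauchy_add:
  assumes "proj_Cauchy u" "proj_Cauchy v"
  shows "proj_Cauchy (\<lambda>n. u n + v n)"
  unfolding proj_Cauchy_def
proof (intro allI impI)
  fix e :: real assume "0 < e"
  then obtain M M' where M: "\<And>m n. m \<ge> M \<Longrightarrow> n \<ge> M \<Longrightarrow> proj_norm (u m - u n) < e / 2"
      "\<And>m n. m \<ge> M' \<Longrightarrow> n \<ge> M' \<Longrightarrow> proj_norm (v m - v n) < e / 2"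
    using assms unfolding proj_Cauchy_def by (meson half_gt_zero)
  have "proj_norm (u m + v m - (u n + v n)) < e" if "m \<ge> max M M'" "n \<ge> max M M'" for m n
    using proj_norm_triangle[of "u m - u n" "v m - v n"] M(1)[of m n] M(2)[of m n] that
    by (simp add: algebra_simps)
  then show "\<exists>M. \<forall>m\<ge>M. \<forall>n\<ge>M. proj_norm (u m + v m - (u n + v n)) < e" by blast
qed

lemma proj_Cauchy_scaleR:
  assumes "proj_Cauchy u"
  shows "proj_Cauchy (\<lambda>n. c *\<^sub>R u n)"
proof (cases "c = 0")
  case False
  have eq: "proj_norm (c *\<^sub>R u m - c *\<^sub>R u n) = \<bar>c\<bar> * proj_norm (u m - u n)" for m n
    by (simp add: proj_norm_scaleR flip: scaleR_diff_right)
  show ?thesis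
    unfolding proj_Cauchy_def eq
  proof (intro allI impI)
    fix e :: real assume "0 < e"
    then have "0 < e / \<bar>c\<bar>" using False by simp
    then obtain M where "\<forall>m\<ge>M. \<forall>n\<ge>M. proj_norm (u m - u n) < e / \<bar>c\<bar>"
      using assms unfolding proj_Cauchy_def by blast
    then show "\<exists>M. \<forall>m\<ge>M. \<forall>n\<ge>M. \<bar>c\<bar> * proj_norm (u m - u n) < e"
      using False by (intro exI[of _ M]) (auto simp: field_simps)
  qed
qed (simp add: proj_Cauchy_const)

lemma proj_Cauchy_norm_convergent:
  assumes "proj_Cauchy u"
  shows "convergent (\<lambda>n. proj_norm (u n))"
proof (rule Cauchy_convergent, rule CauchyI)
  fix e :: real assume "0 < e"
  then obtain M where "\<forall>m\<ge>M. \<forall>n\<ge>M. proj_norm (u m - u n) < e"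
    using assms unfolding proj_Cauchy_def by blast
  then show "\<exists>M. \<forall>m\<ge>M. \<forall>n\<ge>M. norm (proj_norm (u m) - proj_norm (u n)) < e"
    using proj_norm_abs_diff le_less_trans by (metis real_norm_def)
qed

instantiation proj_tensor :: (real_normed_vector, real_normed_vector) real_normed_vector
begin

lift_definition zero_proj_tensor :: "('a, 'b) proj_tensor" is "\<lambda>_. 0"
  by (simp add: proj_equiv_def proj_Cauchy_const)

lift_definition plus_proj_tensor ::
  "('a, 'b) proj_tensor \<Rightarrow> ('a, 'b) proj_tensor \<Rightarrow> ('a, 'b) proj_tensor" is "\<lambda>u v n. u n + v n"
proof -
  fix u u' v v' :: "nat \<Rightarrow> ('a, 'b) tensor"
  assume *: "proj_equiv u u'" "proj_equiv v v'"
  then have "(\<lambda>n. proj_norm (u n - u' n) + proj_norm (v n - v' n)) \<longlonglongrightarrow> 0"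
    using tendsto_add[of "\<lambda>n. proj_norm (u n - u' n)" 0 _ "\<lambda>n. proj_norm (v n - v' n)" 0]
    by (simp add: proj_equiv_def)
  then have "(\<lambda>n. proj_norm (u n + v n - (u' n + v' n))) \<longlonglongrightarrow> 0"
  proof (rule proj_null_squeeze)
    show "proj_norm (u n + v n - (u' n + v' n)) \<le> proj_norm (u n - u' n) + proj_norm (v n - v' n)"
      for n
      using proj_norm_triangle[of "u n - u' n" "v n - v' n"] by (simp add: algebra_simps)
  qed
  then show "proj_equiv (\<lambda>n. u n + v n) (\<lambda>n. u' n + v' n)"
    using * by (simp add: proj_equiv_def proj_Cauchy_add)
qed

lift_definition scaleR_proj_tensor :: "real \<Rightarrow> ('a, 'b) proj_tensor \<Rightarrow> ('a, 'b) proj_tensor"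
  is "\<lambda>c u n. c *\<^sub>R u n"
proof -
  fix c and u u' :: "nat \<Rightarrow> ('a, 'b) tensor"
  assume *: "proj_equiv u u'"
  then have "(\<lambda>n. \<bar>c\<bar> * proj_norm (u n - u' n)) \<longlonglongrightarrow> 0"
    using tendsto_mult_right_zero by (auto simp: proj_equiv_def)
  then have "(\<lambda>n. proj_norm (c *\<^sub>R u n - c *\<^sub>R u' n)) \<longlonglongrightarrow> 0"
    by (simp add: proj_norm_scaleR flip: scaleR_diff_right)
  then show "proj_equiv (\<lambda>n. c *\<^sub>R u n) (\<lambda>n. c *\<^sub>R u' n)"
    using * by (simp add: proj_equiv_def proj_Cauchy_scaleR)
qed

definition "- u = (- 1) *\<^sub>R u" for u :: "('a, 'b) proj_tensor"
definition "u - v = u + - v" for u v :: "('a, 'b) proj_tensor"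

lift_definition norm_proj_tensor :: "('a, 'b) proj_tensor \<Rightarrow> real" is "\<lambda>u. lim (\<lambda>n. proj_norm (u n))"
proof -
  fix u v :: "nat \<Rightarrow> ('a, 'b) tensor"
  assume *: "proj_equiv u v"
  have "(\<lambda>n. proj_norm (u n) - proj_norm (v n)) \<longlonglongrightarrow> 0"
    by (rule Lim_null_comparison[where g = "\<lambda>n. proj_norm (u n - v n)"])
       (use * in \<open>auto simp: proj_equiv_def proj_norm_abs_diff\<close>)
  moreover have "(\<lambda>n. proj_norm (u n) - proj_norm (v n)) \<longlonglongrightarrow>
      lim (\<lambda>n. proj_norm (u n)) - lim (\<lambda>n. proj_norm (v n))"
    using * by (intro tendsto_diff)
      (auto simp: proj_equiv_def convergent_LIMSEQ_iff[symmetric] proj_Cauchy_norm_convergent)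
  ultimately have "lim (\<lambda>n. proj_norm (u n)) - lim (\<lambda>n. proj_norm (v n)) = 0"
    using LIMSEQ_unique by blast
  then show "lim (\<lambda>n. proj_norm (u n)) = lim (\<lambda>n. proj_norm (v n))" by simp
qed

definition "sgn u = inverse (norm u) *\<^sub>R u" for u :: "('a, 'b) proj_tensor"
definition "dist u v = norm (u - v)" for u v :: "('a, 'b) proj_tensor"
definition
  "(uniformity :: (('a, 'b) proj_tensor \<times> ('a, 'b) proj_tensor) filter) =
     (INF e\<in>{0 <..}. principal {(x, y). dist x y < e})"
definition
  "open (S :: ('a, 'b) proj_tensor set) = (\<forall>x\<in>S. \<forall>\<^sub>F (x', y) in uniformity. x' = x \<longrightarrow> y \<in> S)"

lemma proj_equiv_reflI: "proj_Cauchy u \<Longrightarrow> proj_equiv u u"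
  by (simp add: proj_equiv_def)

instance
proof
  fix u v w :: "('a, 'b) proj_tensor" and a b :: real
  show "u + v + w = u + (v + w)"
    by transfer (auto simp: proj_equiv_def add.assoc intro!: proj_Cauchy_add)
  show "u + v = v + u"
    by transfer (auto simp: proj_equiv_def add.commute intro!: proj_Cauchy_add)
  show "0 + u = u" by transfer (simp add: proj_equiv_def)
  show "- u + u = 0" unfolding uminus_proj_tensor_def
    by transfer (simp add: proj_equiv_def proj_Cauchy_const)
  show "u - v = u + - v" by (rule minus_proj_tensor_def)
  show "a *\<^sub>R (u + v) = a *\<^sub>R u + a *\<^sub>R v"
    by transfer (auto simp: scaleR_add_right intro!: proj_equiv_reflI proj_Cauchy_add
        proj_Cauchy_scaleR dest: proj_equiv_def[THEN iffD1])
  show "(a + b) *\<^sub>R u = a *\<^sub>R u + b *\<^sub>R u"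
    by transfer (auto simp: scaleR_add_left intro!: proj_equiv_reflI proj_Cauchy_add
        proj_Cauchy_scaleR dest: proj_equiv_def[THEN iffD1])
  show "a *\<^sub>R b *\<^sub>R u = (a * b) *\<^sub>R u"
    by transfer (auto intro!: proj_equiv_reflI proj_Cauchy_scaleR dest: proj_equiv_def[THEN iffD1])
  show "1 *\<^sub>R u = u" by transfer simp
  show "sgn u = inverse (norm u) *\<^sub>R u" by (rule sgn_proj_tensor_def)
  show "dist u v = norm (u - v)" by (rule dist_proj_tensor_def)
  show "(uniformity :: (('a, 'b) proj_tensor \<times> ('a, 'b) proj_tensor) filter) =
      (INF e\<in>{0 <..}. principal {(x, y). dist x y < e})"
    by (rule uniformity_proj_tensor_def)
  show "open S = (\<forall>x\<in>S. \<forall>\<^sub>F (x', y) in uniformity. x' = x \<longrightarrow> y \<in> S)"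
    for S :: "('a, 'b) proj_tensor set"
    by (rule open_proj_tensor_def)
  show "norm u = 0 \<longleftrightarrow> u = 0"
  proof transfer
    fix u :: "nat \<Rightarrow> ('a, 'b) tensor"
    assume "proj_equiv u u"
    then have u: "proj_Cauchy u" by (simp add: proj_equiv_def)
    then have "(\<lambda>n. proj_norm (u n)) \<longlonglongrightarrow> lim (\<lambda>n. proj_norm (u n))"
      using proj_Cauchy_norm_convergent convergent_LIMSEQ_iff by blast
    then show "lim (\<lambda>n. proj_norm (u n)) = 0 \<longleftrightarrow> proj_equiv u (\<lambda>_. 0)"
      using u by (auto simp: proj_equiv_def proj_Cauchy_const intro: limI)
  qed
  show "norm (u + v) \<le> norm u + norm v"
  proof transfer
    fix u v :: "nat \<Rightarrow> ('a, 'b) tensor"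
    assume "proj_equiv u u" "proj_equiv v v"
    then have "proj_Cauchy u" "proj_Cauchy v" "proj_Cauchy (\<lambda>n. u n + v n)"
      by (auto simp: proj_equiv_def proj_Cauchy_add)
    then have "(\<lambda>n. proj_norm (u n)) \<longlonglongrightarrow> lim (\<lambda>n. proj_norm (u n))"
      "(\<lambda>n. proj_norm (v n)) \<longlonglongrightarrow> lim (\<lambda>n. proj_norm (v n))"
      "(\<lambda>n. proj_norm (u n + v n)) \<longlonglongrightarrow> lim (\<lambda>n. proj_norm (u n + v n))"
      using proj_Cauchy_norm_convergent convergent_LIMSEQ_iff by blast+
    then show "lim (\<lambda>n. proj_norm (u n + v n)) \<le> lim (\<lambda>n. proj_norm (u n)) + lim (\<lambda>n. proj_norm (v n))"
      using LIMSEQ_le[OF _ tendsto_add] proj_norm_triangle by blast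
  qed
  show "norm (a *\<^sub>R u) = \<bar>a\<bar> * norm u"
  proof transfer
    fix a and u :: "nat \<Rightarrow> ('a, 'b) tensor"
    assume "proj_equiv u u"
    then have "(\<lambda>n. proj_norm (u n)) \<longlonglongrightarrow> lim (\<lambda>n. proj_norm (u n))"
      using proj_Cauchy_norm_convergent convergent_LIMSEQ_iff by (auto simp: proj_equiv_def)
    then have "(\<lambda>n. proj_norm (a *\<^sub>R u n)) \<longlonglongrightarrow> \<bar>a\<bar> * lim (\<lambda>n. proj_norm (u n))"
      unfolding proj_norm_scaleR by (rule tendsto_mult_left)
    then show "lim (\<lambda>n. proj_norm (a *\<^sub>R u n)) = \<bar>a\<bar> * lim (\<lambda>n. proj_norm (u n))"
      by (rule limI)
  qed
qed

end

lifting_forget tensor.lifting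

lift_definition to_completion ::
  "('a::real_normed_vector, 'b::real_normed_vector) tensor \<Rightarrow> ('a, 'b) proj_tensor" is "\<lambda>u _. u"
  by (simp add: proj_equiv_def proj_Cauchy_const)

lemma linear_to_completion:
  "linear (to_completion :: ('a::real_normed_vector, 'b::real_normed_vector) tensor \<Rightarrow> _)"
  by (intro linearI; transfer) (simp_all add: proj_equiv_def proj_Cauchy_const)

lemma norm_to_completion: "norm (to_completion u) = proj_norm u"
  by transfer (simp add: limI)

lemma norm_abs_proj_tensor_diff:
  assumes "proj_Cauchy u" "proj_Cauchy v"
  shows "(\<lambda>n. proj_norm (u n - v n)) \<longlonglongrightarrow> norm (abs_proj_tensor u - abs_proj_tensor v)"
proof -
  have diff: "proj_Cauchy (\<lambda>n. u n + (- 1) *\<^sub>R v n)"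
    using assms by (intro proj_Cauchy_add proj_Cauchy_scaleR)
  have "abs_proj_tensor u - abs_proj_tensor v = abs_proj_tensor (\<lambda>n. u n + (- 1) *\<^sub>R v n)"
    unfolding minus_proj_tensor_def uminus_proj_tensor_def
    by (simp only: scaleR_proj_tensor.abs_eq plus_proj_tensor.abs_eq proj_equiv_reflI assms
        proj_Cauchy_scaleR)
  then have "norm (abs_proj_tensor u - abs_proj_tensor v) = lim (\<lambda>n. proj_norm (u n - v n))"
    using norm_proj_tensor.abs_eq[OF proj_equiv_reflI[OF diff]] by simp
  then show ?thesis
    using proj_Cauchy_norm_convergent[OF diff] by (simp add: convergent_LIMSEQ_iff)
qed

lemma to_completion_LIMSEQ:
  assumes "proj_Cauchy u"
  shows "(\<lambda>n. to_completion (u n)) \<longlonglongrightarrow> abs_proj_tensor u"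
proof (rule LIMSEQ_I)
  fix e :: real assume "0 < e"
  then obtain M where M: "\<And>m n. m \<ge> M \<Longrightarrow> n \<ge> M \<Longrightarrow> proj_norm (u m - u n) < e / 2"
    using assms unfolding proj_Cauchy_def by (meson half_gt_zero)
  have "norm (to_completion (u n) - abs_proj_tensor u) < e" if "n \<ge> M" for n
  proof -
    have "(\<lambda>m. proj_norm (u n - u m)) \<longlonglongrightarrow> norm (to_completion (u n) - abs_proj_tensor u)"
      unfolding to_completion.abs_eq
      by (rule norm_abs_proj_tensor_diff[OF proj_Cauchy_const assms])
    then have "norm (to_completion (u n) - abs_proj_tensor u) \<le> e / 2"
      by (rule LIMSEQ_le_const2) (use M that in \<open>meson less_imp_le\<close>)
    then show ?thesis using \<open>0 < e\<close> by simp
  qed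
  then show "\<exists>M. \<forall>n\<ge>M. norm (to_completion (u n) - abs_proj_tensor u) < e" by blast
qed

lemma proj_tensor_approx:
  fixes x :: "('a::real_normed_vector, 'b::real_normed_vector) proj_tensor"
  assumes "0 < e"
  obtains u where "norm (x - to_completion u) < e"
proof -
  have "\<exists>u. x = abs_proj_tensor u \<and> proj_Cauchy u"
    by (induct x rule: proj_tensor.abs_induct) (auto simp: proj_equiv_def)
  then obtain u where u: "x = abs_proj_tensor u" "proj_Cauchy u" by blast
  then obtain n where "norm (to_completion (u n) - x) < e"
    using LIMSEQ_D[OF to_completion_LIMSEQ[OF u(2)] assms] by auto
  then show ?thesis using that by (simp add: norm_minus_commute)
qed

lemma to_completion_dense: "closure (range to_completion) = UNIV"
  unfolding closure_approachable set_eq_iff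
  by (auto simp: dist_norm norm_minus_commute) (meson proj_tensor_approx)

instance proj_tensor :: (real_normed_vector, real_normed_vector) banach
proof
  fix X :: "nat \<Rightarrow> ('a, 'b) proj_tensor"
  assume X: "Cauchy X"
  have "\<exists>u. norm (X n - to_completion u) < inverse (real (Suc n))" for n
    by (rule proj_tensor_approx[of "inverse (real (Suc n))" "X n"]) auto
  then obtain u where u: "\<And>n. norm (X n - to_completion (u n)) < inverse (real (Suc n))"
    by metis
  have null: "(\<lambda>n. X n - to_completion (u n)) \<longlonglongrightarrow> 0"
    by (rule Lim_null_comparison[OF always_eventually LIMSEQ_inverse_real_of_nat])
       (use u in \<open>auto intro: less_imp_le\<close>)
  have "Cauchy (\<lambda>n. to_completion (u n))"
  proof (rule CauchyI)
    fix e :: real assume "0 < e"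
    then have e: "0 < e / 2" by simp
    obtain M where M: "\<And>m n. m \<ge> M \<Longrightarrow> n \<ge> M \<Longrightarrow> norm (X m - X n) < e / 2"
      using CauchyD[OF X e] by blast
    obtain M' where M': "\<And>m n. m \<ge> M' \<Longrightarrow> n \<ge> M' \<Longrightarrow>
        norm ((X m - to_completion (u m)) - (X n - to_completion (u n))) < e / 2"
      using CauchyD[OF LIMSEQ_imp_Cauchy[OF null] e] by blast
    have "norm (to_completion (u m) - to_completion (u n)) < e"
      if "m \<ge> max M M'" "n \<ge> max M M'" for m n
      using M[of m n] M'[of m n] that
        norm_triangle_ineq4[of "X m - X n"
          "(X m - to_completion (u m)) - (X n - to_completion (u n))"]
      by (simp add: algebra_simps)
    then show "\<exists>M. \<forall>m\<ge>M. \<forall>n\<ge>M. norm (to_completion (u m) - to_completion (u n)) < e"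
      by blast
  qed
  then have "proj_Cauchy u"
    unfolding Cauchy_iff proj_Cauchy_def
    by (simp add: norm_to_completion flip: linear_diff[OF linear_to_completion])
  then have "(\<lambda>n. (X n - to_completion (u n)) + to_completion (u n)) \<longlonglongrightarrow> 0 + abs_proj_tensor u"
    by (intro tendsto_add null to_completion_LIMSEQ)
  then show "convergent X" by (auto simp: convergent_def)
qed


section \<open>The operator\<close>

text \<open>On elementary tensors. The inner kernel is singular at \<open>y\<^sub>2 = x\<^sub>2 y\<^sub>1 / x\<^sub>1\<close>. The outer
  integrand is absolutely integrable for \<open>f1\<close> in \<open>L\<^sup>\<infinity>\<close>, \<open>f2\<close> in \<open>H\<^sup>1\<close> and \<open>x\<^sub>1, x\<^sub>2 \<noteq> 0\<close>, so
  that no principal value is needed there. The values on the two coordinate axes are irrelevant,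
  since the operator is only considered almost everywhere.\<close>

definition K_elem :: "(real \<Rightarrow> real) \<Rightarrow> (real \<Rightarrow> real) \<Rightarrow> real \<times> real \<Rightarrow> real" where
  "K_elem f1 f2 = (\<lambda>(x1, x2).
     1 / pi * (LINT y1|lebesgue.
        f1 y1 * pv_integral (x2 * y1 / x1) (\<lambda>y2. f2 y2 / (x1 * y2 - x2 * y1))))"

text \<open>The linear and continuous extension to the whole projective tensor product; \<open>T u\<close> is a class,
  so its agreement with \<open>K_elem\<close> is almost everywhere.\<close>

definition is_K_extension ::
  "(real \<times> real) L0 set \<Rightarrow> ((real \<times> real) L0 \<Rightarrow> real) \<Rightarrow>
   ((Linf, H1) proj_tensor \<Rightarrow> (real \<times> real) L0) \<Rightarrow> bool" where
  "is_K_extension E N T \<longleftrightarrow> bounded_linear_into E N T \<and>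
     (\<forall>f1 f2. AE x in lebesgue.
        rep (T (to_completion (f1 \<otimes> f2))) x = K_elem (rep (fun_Linf f1)) (rep (fun_H1 f2)) x)"

definition weight :: "(real \<times> real) L0" where
  "weight = L0_of (\<lambda>(x1, x2). 1 / \<bar>x2\<bar>)"

end

theory Submission
  imports Defs
begin

text \<open>Pulling the factor \<open>- x\<^sub>1\<close> out of the kernel turns the inner principal value into the Hilbert
  transform of \<open>f2\<close> at \<open>x\<^sub>2 y\<^sub>1 / x\<^sub>1\<close>, up to the factor \<open>- \<pi> / x\<^sub>1\<close>. The substitution
  \<open>s = x\<^sub>2 y\<^sub>1 / x\<^sub>1\<close> in the outer integral then yields
  \<open>\<bar>K (f1 \<otimes> f2) (x\<^sub>1, x\<^sub>2)\<bar> \<le> \<parallel>f1\<parallel> \<parallel>f2\<parallel> / \<bar>x\<^sub>2\<bar>\<close> off the axes. Since \<open>E\<close> is an ideal with a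
  monotone norm, this bounds the bilinear map \<open>(f1, f2) \<mapsto> K (f1 \<otimes> f2)\<close> into \<open>E\<close> by the norm of the
  weight, and the universal property of the projective tensor product gives the operator.\<close>

section \<open>Dilations, null sets and bounded multipliers\<close>

text \<open>The exceptional set of \<open>P\<close> may fail to be Borel, so it is enclosed in a
  Borel null set, for which the affine invariance of \<open>lborel\<close> is available.\<close>

lemma AE_lebesgue_scale:
  fixes c :: real
  assumes "AE x in lebesgue. P x" "c \<noteq> 0"
  shows "AE x in lebesgue. P (c * x)"
proof -
  from assms(1) obtain N where N: "N \<in> null_sets lborel" "{x. \<not> P x} \<subseteq> N"
    unfolding AE_completion_iff unfolding eventually_ae_filter by auto
  then have "AE x in lborel. x \<notin> N"
    by (intro AE_not_in)
  with N(1) \<open>c \<noteq> 0\<close> have "AE x in lborel. 0 + c * x \<notin> N"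
    by (subst AE_borel_affine) (auto simp: null_sets_def)
  then show ?thesis
    unfolding AE_completion_iff using N(2) by (auto elim: eventually_mono)
qed

lemma AE_off_axes: "AE x in lebesgue. fst (x :: real \<times> real) \<noteq> 0 \<and> snd x \<noteq> 0"
proof -
  have "negligible {x. (1, 0) \<bullet> (x :: real \<times> real) = 0}"
    by (rule negligible_hyperplane) (simp add: zero_prod_def)
  moreover have "negligible {x. (0, 1) \<bullet> (x :: real \<times> real) = 0}"
    by (rule negligible_hyperplane) (simp add: zero_prod_def)
  ultimately have "AE x in lebesgue. x \<notin> {x. (1, 0) \<bullet> (x :: real \<times> real) = 0}"
    "AE x in lebesgue. x \<notin> {x. (0, 1) \<bullet> (x :: real \<times> real) = 0}"
    unfolding negligible_iff_null_sets by (blast intro: AE_not_in)+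
  then show ?thesis
    by eventually_elim (auto simp: inner_prod_def)
qed

text \<open>Hoelder's inequality for the exponents infinity and 1.\<close>

lemma bounded_mult_integrable:
  fixes f h :: "'a \<Rightarrow> real"
  assumes f: "f \<in> borel_measurable M" "AE x in M. \<bar>f x\<bar> \<le> c"
    and h: "integrable M h"
  shows "integrable M (\<lambda>x. f x * h x)"
    and "\<bar>LINT x|M. f x * h x\<bar> \<le> c * (LINT x|M. \<bar>h x\<bar>)"
proof -
  have bd: "AE x in M. \<bar>f x * h x\<bar> \<le> c * \<bar>h x\<bar>"
    using f(2) by eventually_elim (simp add: abs_mult mult_right_mono)
  have ch: "integrable M (\<lambda>x. c * \<bar>h x\<bar>)"
    using h by simp
  show *: "integrable M (\<lambda>x. f x * h x)"
    by (rule Bochner_Integration.integrable_bound[OF ch])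
       (use f(1) h bd in \<open>auto elim!: eventually_mono\<close>)
  have "\<bar>LINT x|M. f x * h x\<bar> \<le> (LINT x|M. c * \<bar>h x\<bar>)"
    by (rule order_trans[OF integral_abs_bound integral_mono_AE])
       (use * ch bd in auto)
  then show "\<bar>LINT x|M. f x * h x\<bar> \<le> c * (LINT x|M. \<bar>h x\<bar>)"
    by simp
qed

section \<open>Pointwise formula, bound and measurability for \<open>K_elem\<close>\<close>

text \<open>Both kernels are singular at \<open>s\<close> and truncated on the same sets, so they
  differ by a constant factor and no change of variable is involved. The factor \<open>pi\<close>
  undoes the normalisation of \<open>hilbert_transform\<close>.\<close>

lemma pv_integral_kernel:
  assumes "pv_exists s (\<lambda>y. g y / (s - y))" "s = x2 * y1 / x1" "x1 \<noteq> 0"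
  shows "pv_integral s (\<lambda>y. g y / (x1 * y - x2 * y1)) = - (pi / x1) * hilbert_transform g s"
proof -
  have "g y / (x1 * y - x2 * y1) = - (1 / x1) * (g y / (s - y))" for y
  proof -
    have "x1 * y - x2 * y1 = - x1 * (s - y)"
      using assms by (simp add: field_simps)
    then show ?thesis by simp
  qed
  then show ?thesis
    by (simp only: pv_cmult[OF assms(1)]) (simp add: hilbert_transform_def)
qed

text \<open>The inner principal value is known to exist only at almost every point \<open>s\<close>.
  As \<open>x2 / x1\<close> is nonzero, the exceptional set pulls back to a null set of
  \<open>y\<close>, which the outer integral ignores.\<close>

lemma K_elem_eq:
  assumes f: "f \<in> borel_measurable lebesgue" and g: "hardy g" and x: "x1 \<noteq> 0" "x2 \<noteq> 0"
  shows "K_elem f (rep g) (x1, x2) =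
    - (1 / x1) * (LINT y|lebesgue. f y * hilbert_transform (rep g) (x2 / x1 * y))"
proof -
  let ?h = "\<lambda>y. f y * (- (pi / x1) * hilbert_transform (rep g) (x2 / x1 * y))"
  let ?k = "\<lambda>y. f y * pv_integral (x2 * y / x1) (\<lambda>y2. rep g y2 / (x1 * y2 - x2 * y))"
  have "AE y in lebesgue. pv_exists (x2 / x1 * y) (\<lambda>y2. rep g y2 / (x2 / x1 * y - y2))"
    using g x by (intro AE_lebesgue_scale) (auto simp: hardy_def)
  then have eq: "AE y in lebesgue. ?h y = ?k y"
    by eventually_elim (use x in \<open>simp add: pv_integral_kernel\<close>)
  have "integrable lebesgue (\<lambda>y. hilbert_transform (rep g) (0 + x2 / x1 * y))"
    using g x by (subst lebesgue_integrable_real_affine_iff) (auto simp: hardy_def)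
  then have h: "?h \<in> borel_measurable lebesgue"
    using f by (auto intro!: borel_measurable_times)
  have "(LINT y|lebesgue. ?k y) = (LINT y|lebesgue. ?h y)"
    \<comment> \<open>Measurability of \<open>?k\<close> is inherited from \<open>?h\<close>, since
      Lebesgue measure is complete.\<close>
    by (rule integral_cong_AE[OF borel_measurable_AE[OF h eq] h]) (use eq in \<open>auto elim!: eventually_mono\<close>)
  also have "\<dots> = (LINT y|lebesgue. (- (pi / x1)) * (f y * hilbert_transform (rep g) (x2 / x1 * y)))"
    by (intro Bochner_Integration.integral_cong refl) (simp only: ac_simps)
  also have "\<dots> = - (pi / x1) * (LINT y|lebesgue. f y * hilbert_transform (rep g) (x2 / x1 * y))"
    by (rule integral_mult_right_zero)
  finally show ?thesis
    unfolding K_elem_def by (simp add: field_simps)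
qed

text \<open>The sup norm of \<open>f\<close> is paired with the integral norm of the dilated Hilbert
  transform; the dilation contributes the factor \<open>\<bar>x1 / x2\<bar>\<close>. Integrability
  is what later allows the integral to be split by linearity.\<close>

lemma integrable_K_integrand:
  assumes g: "hardy g" and x: "x1 \<noteq> 0" "x2 \<noteq> 0"
  shows "integrable lebesgue (\<lambda>y. rep (fun_Linf f) y * hilbert_transform (rep g) (x2 / x1 * y))"
    and "\<bar>LINT y|lebesgue. rep (fun_Linf f) y * hilbert_transform (rep g) (x2 / x1 * y)\<bar> \<le>
      \<bar>x1 / x2\<bar> * (norm f * hardy_norm g)"
proof -
  let ?H = "hilbert_transform (rep g)"
  have c: "x2 / x1 \<noteq> 0" using x by simp
  have H: "integrable lebesgue (\<lambda>x. \<bar>?H x\<bar>)" and H': "integrable lebesgue ?H"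
    using g by (auto simp: hardy_def)
  have int: "integrable lebesgue (\<lambda>y. ?H (x2 / x1 * y))"
    using lebesgue_integrable_real_affine_iff[OF c, of ?H 0] H' by simp
  have eq: "(LINT y|lebesgue. \<bar>?H (x2 / x1 * y)\<bar>) = \<bar>x1 / x2\<bar> * (LINT y|lebesgue. \<bar>?H y\<bar>)"
    using lebesgue_integral_real_affine[OF c, of "\<lambda>y. \<bar>?H y\<bar>" 0] x by (simp add: field_simps)
  note bd = bounded_mult_integrable[OF rep_measurable AE_norm_Linf[of f] int]
  show "integrable lebesgue (\<lambda>y. rep (fun_Linf f) y * ?H (x2 / x1 * y))"
    by (rule bd)
  have "(LINT y|lebesgue. \<bar>?H y\<bar>) \<le> hardy_norm g"
    by (simp add: hardy_norm_def)
  then have "norm f * (\<bar>x1 / x2\<bar> * (LINT y|lebesgue. \<bar>?H y\<bar>)) \<le> norm f * (\<bar>x1 / x2\<bar> * hardy_norm g)"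
    by (intro mult_left_mono) auto
  with bd(2) show "\<bar>LINT y|lebesgue. rep (fun_Linf f) y * ?H (x2 / x1 * y)\<bar> \<le>
      \<bar>x1 / x2\<bar> * (norm f * hardy_norm g)"
    unfolding eq by (simp add: mult.left_commute)
qed

text \<open>The prefactor \<open>1 / \<bar>x1\<bar>\<close> cancels against the dilation factor
  \<open>\<bar>x1 / x2\<bar>\<close>, which leaves a bound in \<open>x2\<close> alone.\<close>

lemma K_elem_bound:
  assumes g: "hardy g" and x: "x1 \<noteq> 0" "x2 \<noteq> 0"
  shows "\<bar>K_elem (rep (fun_Linf f)) (rep g) (x1, x2)\<bar> \<le> norm f * hardy_norm g * (1 / \<bar>x2\<bar>)"
proof -
  have "\<bar>K_elem (rep (fun_Linf f)) (rep g) (x1, x2)\<bar> \<le> \<bar>- (1 / x1)\<bar> * (\<bar>x1 / x2\<bar> * (norm f * hardy_norm g))"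
    unfolding K_elem_eq[OF rep_measurable assms] abs_mult[of "- (1 / x1)"]
    by (rule mult_left_mono[OF integrable_K_integrand(2)[OF assms]]) simp
  then show ?thesis using x by (simp add: abs_mult field_simps)
qed

lemma K_elem_measurable:
  assumes g: "hardy g"
  shows "K_elem (rep f) (rep g) \<in> borel_measurable lebesgue"
proof -
  \<comment> \<open>A parameter integral is measurable if its integrand is measurable for a product
    \<open>\<sigma>\<close>-algebra, which the Lebesgue one is not; hence the Borel representatives.\<close>
  let ?H = "hilbert_transform (rep g)"
  obtain f' where f': "f' \<in> borel_measurable borel" "AE x in lborel. rep f x = f' x"
    using completion_ex_borel_measurable_real[OF rep_measurable[of f]] by auto
  obtain h where h: "h \<in> borel_measurable borel" "AE x in lborel. ?H x = h x"
    using completion_ex_borel_measurable_real[of ?H lborel] g by (auto simp: hardy_def)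
  note [measurable] = f'(1) h(1)
  let ?k = "\<lambda>x :: real \<times> real. - (1 / fst x) * (LINT y|lborel. f' y * h (snd x / fst x * y))"
  have "?k \<in> borel_measurable (borel \<Otimes>\<^sub>M borel)"
    by measurable
  then have "?k \<in> borel_measurable borel"
    by (simp only: borel_prod)
  then have k: "?k \<in> borel_measurable lebesgue"
    by (simp add: measurable_completion)
  \<comment> \<open>For each fixed point off the axes, passing to the Borel representatives alters
    the integrand only on a null set of \<open>y\<close>.\<close>
  have eq: "?k (x1, x2) = K_elem (rep f) (rep g) (x1, x2)" if x: "x1 \<noteq> 0" "x2 \<noteq> 0" for x1 x2
  proof -
    have c: "x2 / x1 \<noteq> 0" using x by simp
    have "AE y in lebesgue. ?H (x2 / x1 * y) = h (x2 / x1 * y)"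
      using h(2) c by (intro AE_lebesgue_scale) (auto simp: AE_completion_iff)
    moreover have "AE y in lebesgue. rep f y = f' y"
      using f'(2) by (simp add: AE_completion_iff)
    ultimately have "AE y in lebesgue. rep f y * ?H (x2 / x1 * y) = f' y * h (x2 / x1 * y)"
      by eventually_elim simp
    moreover have m: "(\<lambda>y. f' y * h (x2 / x1 * y)) \<in> borel_measurable borel"
      by measurable
    moreover have "(\<lambda>y. rep f y * ?H (x2 / x1 * y)) \<in> borel_measurable lebesgue"
      using lebesgue_integrable_real_affine_iff[OF c, of ?H 0] g
      by (intro borel_measurable_times rep_measurable) (auto simp: hardy_def)
    ultimately have "(LINT y|lebesgue. rep f y * ?H (x2 / x1 * y)) =
        (LINT y|lebesgue. f' y * h (x2 / x1 * y))"
      by (intro integral_cong_AE) (auto simp: measurable_completion)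
    also have "\<dots> = (LINT y|lborel. f' y * h (x2 / x1 * y))"
      using m by (intro integral_completion) simp
    finally show ?thesis
      using K_elem_eq[OF rep_measurable g x] by simp
  qed
  show ?thesis
    by (rule borel_measurable_AE[OF k]) (use AE_off_axes in eventually_elim, use eq in auto)
qed

section \<open>Universal property of the algebraic tensor product\<close>

text \<open>Tensors are compared through real-valued bilinear forms only; separation by algebraic
  functionals, obtained by extending from \<open>{v}\<close>, carries such comparisons over to
  vector-valued maps.\<close>

lemma linear_functional_separates:
  fixes v :: "'a::real_vector"
  assumes "\<And>\<phi> :: 'a \<Rightarrow> real. linear \<phi> \<Longrightarrow> \<phi> v = 0"
  shows "v = 0"
proof (rule ccontr)
  assume "v \<noteq> 0"
  then have "independent {v}" by simp
  then obtain \<phi> :: "'a \<Rightarrow> real" where \<phi>: "linear \<phi>" "\<forall>x\<in>{v}. \<phi> x = 1"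
    using linear_independent_extend[of "{v}" "\<lambda>_. 1"] by metis
  show False using assms[OF \<phi>(1)] \<phi>(2) by simp
qed

lemma linear_sum_tensor:
  assumes "linear T"
  shows "T (\<Sum>(x, y)\<leftarrow>ps. x \<otimes> y) = (\<Sum>(x, y)\<leftarrow>ps. T (x \<otimes> y))"
  by (induction ps) (auto simp: linear_add[OF assms] linear_0[OF assms])

text \<open>Two representations of one tensor agree on every form, in particular on \<open>B\<close>
  followed by any linear functional. Hence the sums of the values of \<open>B\<close> agree, and
  summing over an arbitrary representation is well defined.\<close>

lemma bilinear_lift_to_tensor:
  fixes B :: "'a::real_vector \<Rightarrow> 'b::real_vector \<Rightarrow> 'c::real_vector"
  assumes B: "bilinear B"
  obtains T where "linear T" "\<And>x y. T (x \<otimes> y) = B x y"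
proof -
  have wd: "(\<Sum>(x, y)\<leftarrow>ps. B x y) = (\<Sum>(x, y)\<leftarrow>qs. B x y)"
    if eq: "(\<Sum>(x, y)\<leftarrow>ps. x \<otimes> y) = (\<Sum>(x, y)\<leftarrow>qs. x \<otimes> y)" for ps qs
  proof -
    have ev: "eval_forms ps = eval_forms qs"
      using eq unfolding sum_elem_tensor by (subst (asm) Abs_tensor_inject) auto
    have "\<phi> ((\<Sum>(x, y)\<leftarrow>ps. B x y) - (\<Sum>(x, y)\<leftarrow>qs. B x y)) = 0"
      if \<phi>: "linear \<phi>" for \<phi> :: "'c \<Rightarrow> real"
    proof -
      have "bilinear (\<lambda>x y. \<phi> (B x y))"
        using B by (auto simp: bilinear_def intro: linear_compose[OF _ \<phi>, unfolded o_def])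
      then have "(\<Sum>(x, y)\<leftarrow>ps. \<phi> (B x y)) = (\<Sum>(x, y)\<leftarrow>qs. \<phi> (B x y))"
        using fun_cong[OF ev, of "\<lambda>x y. \<phi> (B x y)"] by (simp add: eval_forms_def)
      moreover have "\<phi> (\<Sum>(x, y)\<leftarrow>rs. B x y) = (\<Sum>(x, y)\<leftarrow>rs. \<phi> (B x y))" for rs
        by (induction rs) (auto simp: linear_add[OF \<phi>] linear_0[OF \<phi>])
      ultimately show ?thesis by (simp add: linear_diff[OF \<phi>])
    qed
    then have "(\<Sum>(x, y)\<leftarrow>ps. B x y) - (\<Sum>(x, y)\<leftarrow>qs. B x y) = 0"
      by (rule linear_functional_separates)
    then show ?thesis by simp
  qed
  \<comment> \<open>Any representation may be chosen: by \<open>wd\<close> the value does not depend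
    on it.\<close>
  define T where "T u = (\<Sum>(x, y)\<leftarrow>(SOME ps. u = (\<Sum>(x, y)\<leftarrow>ps. x \<otimes> y)). B x y)" for u
  have T: "T (\<Sum>(x, y)\<leftarrow>ps. x \<otimes> y) = (\<Sum>(x, y)\<leftarrow>ps. B x y)" for ps
    unfolding T_def by (rule wd, rule sym, rule someI[where P = "\<lambda>qs. _ = (\<Sum>(x, y)\<leftarrow>qs. x \<otimes> y)"]) (rule refl)
  show thesis
  proof
    show "T (x \<otimes> y) = B x y" for x y
      using T[of "[(x, y)]"] by simp
    show "linear T"
    proof (rule linearI)
      fix u v :: "('a, 'b) tensor" and c :: real
      obtain ps where ps: "u = (\<Sum>(x, y)\<leftarrow>ps. x \<otimes> y)" by (rule tensor_repr)
      obtain qs where qs: "v = (\<Sum>(x, y)\<leftarrow>qs. x \<otimes> y)" by (rule tensor_repr)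
      have "u + v = (\<Sum>(x, y)\<leftarrow>ps @ qs. x \<otimes> y)" by (simp add: ps qs)
      then show "T (u + v) = T u + T v" by (simp only: T ps qs) simp
      have "c *\<^sub>R u = (\<Sum>(x, y)\<leftarrow>map (\<lambda>(x, y). (c *\<^sub>R x, y)) ps. x \<otimes> y)"
        unfolding ps
        by (induction ps) (auto simp: bilinear_lmul[OF tensor_bilinear] scaleR_add_right)
      then have "T (c *\<^sub>R u) = (\<Sum>(x, y)\<leftarrow>map (\<lambda>(x, y). (c *\<^sub>R x, y)) ps. B x y)"
        by (simp only: T)
      also have "\<dots> = c *\<^sub>R (\<Sum>(x, y)\<leftarrow>ps. B x y)"
        by (induction ps) (auto simp: bilinear_lmul[OF B] scaleR_add_right)
      finally show "T (c *\<^sub>R u) = c *\<^sub>R T u" by (simp only: T ps)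
    qed
  qed
qed

section \<open>Bounded operators into a Banach function lattice\<close>

context banach_function_lattice
begin

lemma N_zero: "N 0 = 0"
  using N_eq_zero[of 0] subspace_0[OF subspace_E] by simp

lemma N_diff_commute: "f \<in> E \<Longrightarrow> g \<in> E \<Longrightarrow> N (f - g) = N (g - f)"
  using N_scaleR[of "g - f" "- 1"] subspace_diff[OF subspace_E, of g f] by simp

lemma N_diff_triangle: "f \<in> E \<Longrightarrow> g \<in> E \<Longrightarrow> h \<in> E \<Longrightarrow> N (f - h) \<le> N (f - g) + N (g - h)"
  using N_triangle[of "f - g" "g - h"] by (simp add: subspace_diff[OF subspace_E])

lemma sum_list_bound:
  assumes "\<And>p. p \<in> set ps \<Longrightarrow> F p \<in> E" "\<And>p. p \<in> set ps \<Longrightarrow> N (F p) \<le> b p"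
  shows "(\<Sum>p\<leftarrow>ps. F p) \<in> E \<and> N (\<Sum>p\<leftarrow>ps. F p) \<le> (\<Sum>p\<leftarrow>ps. b p)"
  using assms
proof (induction ps)
  case Nil
  then show ?case by (simp add: N_zero subspace_0[OF subspace_E])
next
  case (Cons p ps)
  then have "F p \<in> E" "N (F p) \<le> b p" "(\<Sum>p\<leftarrow>ps. F p) \<in> E"
    "N (\<Sum>p\<leftarrow>ps. F p) \<le> (\<Sum>p\<leftarrow>ps. b p)"
    by auto
  then show ?case
    using N_triangle[of "F p" "\<Sum>p\<leftarrow>ps. F p"] by (simp add: subspace_add[OF subspace_E])
qed

text \<open>The extension comes from the closure \<open>G\<close> of the graph of \<open>T0\<close>: \<open>G\<close> is a linear relation,
  is total by completeness, and the bound, which passes to the closure, makes it single valued.\<close>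

lemma bounded_extension:
  fixes J :: "'b::real_vector \<Rightarrow> 'c::real_normed_vector"
  assumes J: "linear J" and dense: "\<And>x e. 0 < e \<Longrightarrow> \<exists>u. norm (x - J u) < e"
    and T0: "linear T0" "\<And>u. T0 u \<in> E" "\<And>u. N (T0 u) \<le> C * norm (J u)"
    and C: "0 \<le> C"
  obtains T where "linear T" "\<And>x. T x \<in> E" "\<And>x. N (T x) \<le> C * norm x" "\<And>u. T (J u) = T0 u"
proof -
  define G where "G x f \<longleftrightarrow> f \<in> E \<and> (\<forall>e>0. \<exists>u. norm (x - J u) < e \<and> N (f - T0 u) < e)" for x f
  note Emem = subspace_diff[OF subspace_E] subspace_add[OF subspace_E] subspace_scale[OF subspace_E] T0(2)
  have G_E: "f \<in> E" if "G x f" for x f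
    using that by (simp add: G_def)
  have G_graph: "G (J u) (T0 u)" for u
    unfolding G_def using T0(2) by (auto intro!: exI[of _ u] simp: N_zero)
  have G_add: "G (x + y) (f + g)" if fg: "G x f" "G y g" for x y f g
    unfolding G_def
  proof (intro conjI allI impI)
    show "f + g \<in> E" by (intro Emem G_E[OF fg(1)] G_E[OF fg(2)])
    fix e :: real assume "0 < e"
    then have e: "0 < e / 2" by simp
    obtain u where u: "norm (x - J u) < e / 2" "N (f - T0 u) < e / 2"
      using fg(1) e unfolding G_def by blast
    obtain v where v: "norm (y - J v) < e / 2" "N (g - T0 v) < e / 2"
      using fg(2) e unfolding G_def by blast
    have "norm (x + y - J (u + v)) < e"
      using u(1) v(1) norm_triangle_ineq[of "x - J u" "y - J v"]
      by (simp add: linear_add[OF J] algebra_simps)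
    moreover have "N (f + g - T0 (u + v)) < e"
      using u(2) v(2)
        N_triangle[OF Emem(1)[OF G_E[OF fg(1)] T0(2)[of u]] Emem(1)[OF G_E[OF fg(2)] T0(2)[of v]]]
      by (simp add: linear_add[OF T0(1)] algebra_simps)
    ultimately show "\<exists>u. norm (x + y - J u) < e \<and> N (f + g - T0 u) < e" by blast
  qed
  have G_scale: "G (c *\<^sub>R x) (c *\<^sub>R f)" if fg: "G x f" for c x f
    unfolding G_def
  proof (intro conjI allI impI)
    show "c *\<^sub>R f \<in> E" by (intro Emem G_E[OF fg])
    fix e :: real assume e: "0 < e"
    \<comment> \<open>Adding 1 keeps the denominator positive for \<open>c = 0\<close>.\<close>
    define d where "d = e / (\<bar>c\<bar> + 1)"
    have "0 < d" using e by (simp add: d_def)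
    then obtain u where u: "norm (x - J u) < d" "N (f - T0 u) < d"
      using fg unfolding G_def by blast
    have cd: "\<bar>c\<bar> * t < e" if "t < d" "0 \<le> t" for t
    proof -
      have "\<bar>c\<bar> * t \<le> (\<bar>c\<bar> + 1) * t" using that by (intro mult_right_mono) auto
      also have "\<dots> < (\<bar>c\<bar> + 1) * d" using that by (intro mult_strict_left_mono) auto
      also have "\<dots> = e" by (simp add: d_def)
      finally show ?thesis .
    qed
    have "norm (c *\<^sub>R x - J (c *\<^sub>R u)) < e"
      using cd[OF u(1)] by (simp add: linear_scale[OF J] flip: scaleR_diff_right)
    moreover have fu: "f - T0 u \<in> E" by (intro Emem G_E[OF fg])
    have "N (c *\<^sub>R f - T0 (c *\<^sub>R u)) < e"
      using cd[OF u(2)] N_scaleR[OF fu, of c] N_nonneg[OF fu]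
      by (simp add: linear_scale[OF T0(1)] flip: scaleR_diff_right)
    ultimately show "\<exists>u. norm (c *\<^sub>R x - J u) < e \<and> N (c *\<^sub>R f - T0 u) < e" by blast
  qed
  have G_bound: "N f \<le> C * norm x" if fg: "G x f" for x f
  proof (rule field_le_epsilon)
    fix e :: real assume e: "0 < e"
    \<comment> \<open>The error is \<open>d\<close> from \<open>f - T0 u\<close> plus
      \<open>C * d\<close> from replacing \<open>J u\<close> by \<open>x\<close>, that is
      \<open>e\<close> in total.\<close>
    define d where "d = e / (C + 1)"
    have "0 < d" using e C by (simp add: d_def)
    then obtain u where u: "norm (x - J u) < d" "N (f - T0 u) < d"
      using fg unfolding G_def by blast
    have "norm (J u) \<le> norm x + d"
      using u(1) norm_triangle_ineq2[of "J u" x] by (simp add: norm_minus_commute)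
    then have "C * norm (J u) \<le> C * (norm x + d)" using C by (rule mult_left_mono)
    moreover have "N f \<le> N (f - T0 u) + N (T0 u)"
      using N_triangle[OF Emem(1)[OF G_E[OF fg] T0(2)] T0(2), of u u] by simp
    ultimately have "N f \<le> C * norm x + (C + 1) * d"
      using u(2) T0(3)[of u] by (simp add: algebra_simps)
    also have "(C + 1) * d = e" using C by (simp add: d_def)
    finally show "N f \<le> C * norm x + e" by simp
  qed
  have G_unique: "f = g" if "G x f" "G x g" for x f g
  proof -
    \<comment> \<open>By linearity \<open>f - g\<close> is related to 0, where the bound forces its
      norm to vanish.\<close>
    have "G (x + (- 1) *\<^sub>R x) (f + (- 1) *\<^sub>R g)" by (intro G_add G_scale that)
    then have "N (f - g) \<le> 0" "f - g \<in> E" using G_bound[of 0 "f - g"] G_E[of 0 "f - g"] by simp_all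
    then have "N (f - g) = 0" using N_nonneg[of "f - g"] by simp
    then show ?thesis using N_eq_zero \<open>f - g \<in> E\<close> by simp
  qed
  have G_total: "\<exists>f. G x f" for x
  proof -
    have "\<exists>u. norm (x - J u) < inverse (real (Suc n))" for n
      by (rule dense) simp
    then obtain u where u: "\<And>n. norm (x - J (u n)) < inverse (real (Suc n))" by metis
    have lim: "(\<lambda>n. norm (x - J (u n))) \<longlonglongrightarrow> 0"
      by (rule tendsto_sandwich[OF _ _ tendsto_const LIMSEQ_inverse_real_of_nat])
         (use u in \<open>auto intro!: always_eventually less_imp_le\<close>)
    have "(\<lambda>n. x - J (u n)) \<longlonglongrightarrow> 0" using lim by (rule tendsto_norm_zero_cancel)
    then have Cau: "Cauchy (\<lambda>n. x - J (u n))" by (rule LIMSEQ_imp_Cauchy)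
    \<comment> \<open>The elements \<open>J (u n)\<close> approach \<open>x\<close>, so the bound
      makes \<open>T0 (u n)\<close> a Cauchy sequence in \<open>E\<close>.\<close>
    have "\<exists>f\<in>E. (\<lambda>n. N (T0 (u n) - f)) \<longlonglongrightarrow> 0"
    proof (rule complete_E)
      show "T0 (u n) \<in> E" for n by (rule T0)
      fix e :: real assume e: "0 < e"
      then have "0 < e / (C + 1)" using C by simp
      then obtain M where M: "\<And>m n. m \<ge> M \<Longrightarrow> n \<ge> M \<Longrightarrow>
          norm ((x - J (u m)) - (x - J (u n))) < e / (C + 1)"
        using CauchyD[OF Cau] by blast
      have "N (T0 (u m) - T0 (u n)) < e" if "m \<ge> M" "n \<ge> M" for m n
      proof -
        have "N (T0 (u m) - T0 (u n)) \<le> C * norm (J (u m) - J (u n))"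
          using T0(3)[of "u m - u n"] by (simp add: linear_diff[OF T0(1)] linear_diff[OF J])
        \<comment> \<open>The larger constant is positive even if \<open>C = 0\<close>, as the
          strict inequality below requires.\<close>
        also have "\<dots> \<le> (C + 1) * norm (J (u m) - J (u n))" by (intro mult_right_mono) auto
        also have "\<dots> < (C + 1) * (e / (C + 1))"
          using M[OF that] C by (intro mult_strict_left_mono) (auto simp: norm_minus_commute)
        finally show ?thesis using C by simp
      qed
      then show "\<exists>M. \<forall>m\<ge>M. \<forall>n\<ge>M. N (T0 (u m) - T0 (u n)) < e" by blast
    qed
    then obtain f where f: "f \<in> E" "(\<lambda>n. N (T0 (u n) - f)) \<longlonglongrightarrow> 0" by blast
    have "G x f"
      unfolding G_def
    proof (intro conjI allI impI f(1))
      fix e :: real assume e: "0 < e"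
      have "\<forall>\<^sub>F n in sequentially. norm (x - J (u n)) < e \<and> N (T0 (u n) - f) < e"
        using order_tendstoD(2)[OF lim e] order_tendstoD(2)[OF f(2) e] by (rule eventually_conj)
      then obtain n where "norm (x - J (u n)) < e" "N (T0 (u n) - f) < e"
        by (auto simp: eventually_sequentially)
      then show "\<exists>u. norm (x - J u) < e \<and> N (f - T0 u) < e"
        using N_diff_commute[OF f(1) T0(2)] by auto
    qed
    then show ?thesis by blast
  qed
  then obtain T where T: "\<And>x. G x (T x)" by metis
  show thesis
  proof
    show "linear T"
      by (intro linearI; rule G_unique[OF T]) (intro G_add G_scale T)+
    show "T x \<in> E" for x by (rule G_E[OF T])
    show "N (T x) \<le> C * norm x" for x by (rule G_bound[OF T])
    \<comment> \<open>Single-valuedness also shows that \<open>T0 u\<close> depends only on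
      \<open>J u\<close>.\<close>
    show "T (J u) = T0 u" for u by (rule G_unique[OF T G_graph])
  qed
qed

text \<open>The usual density argument, carried out with \<open>N\<close> by hand because
  \<open>E\<close> is a set and not a normed type.\<close>

lemma bounded_linear_into_eqI:
  assumes T: "bounded_linear_into E N T" and S: "bounded_linear_into E N S"
    and dense: "\<And>x e. 0 < e \<Longrightarrow> \<exists>u. norm (x - J u) < e"
    and eq: "\<And>u. T (J u) = S (J u)"
  shows "T = S"
proof
  fix x
  have mem: "T y \<in> E" "S y \<in> E" for y using T S by (auto simp: bounded_linear_into_def)
  have lin: "linear T" "linear S" using T S by (auto simp: bounded_linear_into_def)
  obtain A where A: "\<And>y. N (T y) \<le> A * norm y"
    using T by (auto simp: bounded_linear_into_def)
  obtain B where B: "\<And>y. N (S y) \<le> B * norm y"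
    using S by (auto simp: bounded_linear_into_def)
  \<comment> \<open>The constants \<open>A\<close> and \<open>B\<close> come without a sign; this
    one dominates their sum and is positive, so that \<open>e / C\<close> makes sense.\<close>
  define C where "C = \<bar>A\<bar> + \<bar>B\<bar> + 1"
  have AB: "N (T y) + N (S y) \<le> C * norm y" for y
  proof -
    have "N (T y) + N (S y) \<le> (A + B) * norm y"
      using add_mono[OF A[of y] B[of y]] by (simp only: distrib_right)
    also have "\<dots> \<le> C * norm y" by (rule mult_right_mono) (auto simp: C_def)
    finally show ?thesis .
  qed
  have C: "0 < C" by (simp add: C_def add_nonneg_pos add_pos_nonneg)
  have "N (T x - S x) \<le> 0"
  proof (rule field_le_epsilon)
    fix e :: real assume "0 < e"
    then obtain u where u: "norm (x - J u) < e / C" using dense[of "e / C"] C by auto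
    have "N (T x - S x) \<le> N (T x - T (J u)) + N (T (J u) - S x)"
      by (rule N_diff_triangle) (rule mem)+
    also have "\<dots> = N (T (x - J u)) + N (S (x - J u))"
      using N_diff_commute[of "S (J u)" "S x"] by (simp add: eq mem linear_diff[OF lin(1)] linear_diff[OF lin(2)])
    also have "\<dots> \<le> C * norm (x - J u)" by (rule AB)
    also have "\<dots> \<le> C * (e / C)" using u C by (intro mult_left_mono) auto
    finally show "N (T x - S x) \<le> 0 + e" using C by simp
  qed
  moreover have "T x - S x \<in> E" using mem by (intro subspace_diff[OF subspace_E])
  ultimately show "T x = S x" using N_nonneg[of "T x - S x"] N_eq_zero[of "T x - S x"] by simp
qed

text \<open>A bound on elementary tensors passes to any representation by the triangle inequality,
  and then to the infimum over representations.\<close>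

lemma tensor_bound:
  assumes T: "linear T"
    and elem: "\<And>x y. T (x \<otimes> y) \<in> E" "\<And>x y. N (T (x \<otimes> y)) \<le> C * (norm x * norm y)"
    and C: "0 \<le> C"
  shows "T u \<in> E" and "N (T u) \<le> C * proj_norm u"
proof -
  have list: "T (\<Sum>(x, y)\<leftarrow>ps. x \<otimes> y) \<in> E \<and>
      N (T (\<Sum>(x, y)\<leftarrow>ps. x \<otimes> y)) \<le> C * (\<Sum>(x, y)\<leftarrow>ps. norm x * norm y)" for ps
    using sum_list_bound[of ps "\<lambda>(x, y). T (x \<otimes> y)" "\<lambda>(x, y). C * (norm x * norm y)"] elem
    unfolding linear_sum_tensor[OF T] by (simp add: case_prod_unfold sum_list_const_mult)
  show "T u \<in> E" by (rule tensor_repr[of u]) (simp add: list)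
  show "N (T u) \<le> C * proj_norm u"
  proof (rule field_le_epsilon)
    fix e :: real assume e: "0 < e"
    then have "proj_norm u < proj_norm u + e / (C + 1)" using C by simp
    then obtain ps where ps: "u = (\<Sum>(x, y)\<leftarrow>ps. x \<otimes> y)"
        "(\<Sum>(x, y)\<leftarrow>ps. norm x * norm y) < proj_norm u + e / (C + 1)"
      by (rule proj_norm_approx)
    have "N (T u) \<le> C * (\<Sum>(x, y)\<leftarrow>ps. norm x * norm y)" using list ps(1) by blast
    also have "\<dots> \<le> C * (proj_norm u + e / (C + 1))" using ps(2) C by (intro mult_left_mono) auto
    also have "\<dots> \<le> C * proj_norm u + e" using C e by (simp add: field_simps)
    finally show "N (T u) \<le> C * proj_norm u + e" .
  qed
qed

end

section \<open>The operator as a bilinear map into classes\<close>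

text \<open>\<open>L0_of\<close> is meaningful only on measurable functions, so this relies on
  \<open>K_elem_measurable\<close>.\<close>

definition K_class :: "Linf \<Rightarrow> H1 \<Rightarrow> (real \<times> real) L0" where
  "K_class f g = L0_of (K_elem (rep (fun_Linf f)) (rep (fun_H1 g)))"

lemma hardy_fun_H1: "hardy (fun_H1 g)"
  using fun_H1[of g] by simp

lemma AE_rep_K_class:
  "AE x in lebesgue. rep (K_class f g) x = K_elem (rep (fun_Linf f)) (rep (fun_H1 g)) x"
  unfolding K_class_def by (intro AE_rep_L0_of K_elem_measurable hardy_fun_H1)

text \<open>In this form linearity can be read off: \<open>f\<close> enters directly and
  \<open>g\<close> through its Hilbert transform, without principal values in the outer
  integrand.\<close>

lemma AE_rep_K_class_eq:
  "AE x in lebesgue. rep (K_class f g) x = - (1 / fst x) *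
    (LINT y|lebesgue. rep (fun_Linf f) y * hilbert_transform (rep (fun_H1 g)) (snd x / fst x * y))"
  using AE_rep_K_class[of f g] AE_off_axes
proof eventually_elim
  case (elim x)
  then show ?case
    using K_elem_eq[OF rep_measurable hardy_fun_H1, of "fst x" "snd x"] by simp
qed

lemma integral_lincomb_AE:
  fixes F f g :: "'a \<Rightarrow> real"
  assumes "integrable M F" "integrable M f" "integrable M g"
    and "AE y in M. F y = f y + c * g y"
  shows "integral\<^sup>L M F = integral\<^sup>L M f + c * integral\<^sup>L M g"
proof -
  have "integral\<^sup>L M F = (LINT y|M. f y + c * g y)"
    using assms by (intro integral_cong_AE) auto
  then show ?thesis using assms by simp
qed

lemma L0_lincombI:
  assumes "AE x in lebesgue. rep h x = rep f x + c * rep g x"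
  shows "h = f + c *\<^sub>R g"
  using assms AE_rep_add[of f "c *\<^sub>R g"] AE_rep_scaleR[of c g]
  by (intro L0_eqI, eventually_elim) simp

lemma K_class_lincomb_left: "K_class (f + c *\<^sub>R f') g = K_class f g + c *\<^sub>R K_class f' g"
proof (rule L0_lincombI)
  show "AE x in lebesgue. rep (K_class (f + c *\<^sub>R f') g) x =
      rep (K_class f g) x + c * rep (K_class f' g) x"
    using AE_rep_K_class_eq[of "f + c *\<^sub>R f'" g] AE_rep_K_class_eq[of f g]
      AE_rep_K_class_eq[of f' g] AE_off_axes
  proof eventually_elim
    case (elim x)
    let ?H = "\<lambda>y. hilbert_transform (rep (fun_H1 g)) (snd x / fst x * y)"
    note int = integrable_K_integrand(1)[OF hardy_fun_H1[of g], of "fst x" "snd x"]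
    have "AE y in lebesgue. rep (fun_Linf (f + c *\<^sub>R f')) y * ?H y =
        rep (fun_Linf f) y * ?H y + c * (rep (fun_Linf f') y * ?H y)"
      using AE_rep_add[of "fun_Linf f" "c *\<^sub>R fun_Linf f'"] AE_rep_scaleR[of c "fun_Linf f'"]
      unfolding plus_Linf.rep_eq scaleR_Linf.rep_eq
      by eventually_elim (simp add: algebra_simps)
    from integral_lincomb_AE[OF int int int this] show ?case
      using elim by (simp add: algebra_simps)
  qed
qed

lemma K_class_lincomb_right: "K_class f (g + c *\<^sub>R g') = K_class f g + c *\<^sub>R K_class f g'"
proof (rule L0_lincombI)
  show "AE x in lebesgue. rep (K_class f (g + c *\<^sub>R g')) x =
      rep (K_class f g) x + c * rep (K_class f g') x"
    using AE_rep_K_class_eq[of f "g + c *\<^sub>R g'"] AE_rep_K_class_eq[of f g]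
      AE_rep_K_class_eq[of f g'] AE_off_axes
  proof eventually_elim
    case (elim x)
    let ?H = "\<lambda>g y. hilbert_transform (rep (fun_H1 g)) (snd x / fst x * y)"
    note int = integrable_K_integrand(1)[OF hardy_fun_H1, of "fst x" "snd x"]
    have "AE s in lebesgue. hilbert_transform (rep (fun_H1 (g + c *\<^sub>R g'))) s =
        hilbert_transform (rep (fun_H1 g)) s + c * hilbert_transform (rep (fun_H1 g')) s"
      using AE_hilbert_add[OF hardy_fun_H1[of g] hardy_fun_H1[of "c *\<^sub>R g'"]]
        AE_hilbert_scaleR[OF hardy_fun_H1[of g'], of c]
      unfolding plus_H1.rep_eq scaleR_H1.rep_eq by eventually_elim simp
    \<comment> \<open>Linearity of the Hilbert transform holds only at almost every
      \<open>s\<close>; off the axes the dilation carries this over to almost every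
      \<open>y\<close>.\<close>
    then have "AE y in lebesgue. ?H (g + c *\<^sub>R g') y = ?H g y + c * ?H g' y"
      by (rule AE_lebesgue_scale) (use elim in simp)
    then have "AE y in lebesgue. rep (fun_Linf f) y * ?H (g + c *\<^sub>R g') y =
        rep (fun_Linf f) y * ?H g y + c * (rep (fun_Linf f) y * ?H g' y)"
      by eventually_elim (simp add: algebra_simps)
    from integral_lincomb_AE[OF int int int this] show ?case
      using elim by (simp add: algebra_simps)
  qed
qed

lemma linear_if_lincomb:
  fixes T :: "'a::real_vector \<Rightarrow> 'b::real_vector"
  assumes "\<And>u v c. T (u + c *\<^sub>R v) = T u + c *\<^sub>R T v"
  shows "linear T"
proof (rule linearI)
  \<comment> \<open>With \<open>u = v = 0\<close> and \<open>c = 1\<close> the assumption reads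
    \<open>T 0 = T 0 + T 0\<close>.\<close>
  have T0: "T 0 = 0" using assms[of 0 1 0] by simp
  fix u v and c :: real
  show "T (u + v) = T u + T v" using assms[of u 1 v] by simp
  show "T (c *\<^sub>R u) = c *\<^sub>R T u" using assms[of 0 c u] T0 by simp
qed

lemma bilinear_K_class: "bilinear K_class"
  unfolding bilinear_def
  by (intro conjI allI linear_if_lincomb K_class_lincomb_left K_class_lincomb_right)

lemma AE_rep_weight: "AE x in lebesgue. rep weight x = 1 / \<bar>snd x\<bar>"
proof -
  have "(\<lambda>x :: real \<times> real. 1 / \<bar>snd x\<bar>) \<in> borel_measurable (borel \<Otimes>\<^sub>M borel)" by measurable
  then have "(\<lambda>(x1, x2). 1 / \<bar>x2 :: real\<bar>) \<in> borel_measurable (lebesgue :: (real \<times> real) measure)"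
    by (simp add: borel_prod case_prod_unfold measurable_completion)
  from AE_rep_L0_of[OF this] show ?thesis
    unfolding weight_def by (simp add: case_prod_unfold)
qed

text \<open>This is the domination that \<open>ideal_E\<close> and \<open>N_mono\<close> ask for: it
  gives membership in \<open>E\<close> together with the constant \<open>N weight\<close>.\<close>

lemma K_class_bound:
  "AE x in lebesgue. \<bar>rep (K_class f g) x\<bar> \<le> \<bar>rep ((norm f * norm g) *\<^sub>R weight) x\<bar>"
  using AE_rep_K_class[of f g] AE_rep_scaleR[of "norm f * norm g" weight] AE_rep_weight AE_off_axes
proof eventually_elim
  case (elim x)
  then show ?case
    using K_elem_bound[OF hardy_fun_H1[of g], of "fst x" "snd x" f]
    by (simp add: abs_mult norm_H1.rep_eq[symmetric])
qed

section \<open>Existence, uniqueness and norm of the extension\<close>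

theorem theorem13:
  fixes E :: "(real \<times> real) L0 set" and N :: "(real \<times> real) L0 \<Rightarrow> real"
  assumes "banach_function_lattice E N"
    and "weight \<in> E"
  shows "(\<exists>!K. is_K_extension E N K) \<and>
    (\<forall>K. is_K_extension E N K \<longrightarrow> operator_norm N K \<le> N weight)"
proof -
  interpret banach_function_lattice E N by fact
  have w: "0 \<le> N weight" by (rule N_nonneg) fact
  have dense: "\<exists>u. norm (x - to_completion u) < e" if "0 < e" for e and x :: "(Linf, H1) proj_tensor"
    using proj_tensor_approx[OF that] by metis
  obtain T0 where T0: "linear T0" "\<And>f g. T0 (f \<otimes> g) = K_class f g"
    using bilinear_lift_to_tensor[OF bilinear_K_class] by metis
  have wE: "c *\<^sub>R weight \<in> E" for c by (rule subspace_scale[OF subspace_E \<open>weight \<in> E\<close>])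
  have elem: "T0 (f \<otimes> g) \<in> E" "N (T0 (f \<otimes> g)) \<le> N weight * (norm f * norm g)" for f g
    unfolding T0(2)
    using ideal_E[OF wE K_class_bound] N_mono[OF wE K_class_bound, of f g]
    by (simp_all add: N_scaleR[OF \<open>weight \<in> E\<close>] mult.commute)
  \<comment> \<open>\<open>to_completion\<close> carries \<open>proj_norm\<close> to the norm of the
    completion, so the bound from \<open>tensor_bound\<close> is the one that the extension
    needs.\<close>
  obtain T where T: "linear T" "\<And>x. T x \<in> E" "\<And>x. N (T x) \<le> N weight * norm x"
      "\<And>u. T (to_completion u) = T0 u"
    by (rule bounded_extension[OF linear_to_completion dense T0(1) _ _ w, unfolded norm_to_completion])
       (use tensor_bound[OF T0(1) elem w] in auto)
  have blT: "bounded_linear_into E N T"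
    unfolding bounded_linear_into_def using T(1-3) by blast
  have extT: "is_K_extension E N T"
    unfolding is_K_extension_def using blT T(4) T0(2) AE_rep_K_class by simp
  \<comment> \<open>On an elementary tensor both operators equal the same function almost
    everywhere, hence the same class; linearity and density do the rest.\<close>
  have unique: "K = T" if K: "is_K_extension E N K" for K
  proof (rule bounded_linear_into_eqI[OF _ blT dense])
    show blK: "bounded_linear_into E N K" using K by (simp add: is_K_extension_def)
    have lin: "linear (\<lambda>u. K (to_completion u))" "linear (\<lambda>u. T (to_completion u))"
      using linear_compose[OF linear_to_completion] blK T(1)
      by (auto simp: bounded_linear_into_def o_def)
    have elem_eq: "K (to_completion (f \<otimes> g)) = T (to_completion (f \<otimes> g))" for f g
    proof (rule L0_eqI)
      have "AE x in lebesgue. rep (K (to_completion (f \<otimes> g))) x = K_elem (rep (fun_Linf f)) (rep (fun_H1 g)) x"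
        "AE x in lebesgue. rep (T (to_completion (f \<otimes> g))) x = K_elem (rep (fun_Linf f)) (rep (fun_H1 g)) x"
        using K extT by (auto simp: is_K_extension_def)
      then show "AE x in lebesgue. rep (K (to_completion (f \<otimes> g))) x = rep (T (to_completion (f \<otimes> g))) x"
        by eventually_elim simp
    qed
    show "K (to_completion u) = T (to_completion u)" for u
      by (rule tensor_repr[of u])
         (simp add: elem_eq linear_sum_tensor[OF lin(1)] linear_sum_tensor[OF lin(2)])
  qed
  \<comment> \<open>By uniqueness it is enough to bound the norm of \<open>T\<close>. At
    \<open>u = 0\<close> the quotient is 0, as division by zero yields 0.\<close>
  have "operator_norm N T \<le> N weight"
    unfolding operator_norm_def
  proof (rule cSUP_least)
    show "N (T u) / norm u \<le> N weight" for u
      using T(3)[of u] w by (cases "u = 0") (auto simp: divide_le_eq)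
  qed simp
  then show ?thesis using extT unique by blast
qed

end
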